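(* Suppose that for every free of infinity Coxeter graph $\Gamma$ the Artin-Tits group $A_\Gamma$ has a solution to the word problem. Then for every Coxeter graph $\Gamma$ the Artin-Tits group $A_\Gamma$ has a solution to the word problem.
   Context: Let $S$ be a finite set. A Coxeter matrix over $S$ is a square matrix $M=(m_{s,t})_{s,t\in S}$ with $m_{s,s}=1$ for all $s\in S$ and $m_{s,t}=m_{t,s}\in\{2,3,4,\dots,\infty\}$ for all $s\neq t$ in $S$. It is represented by its Coxeter graph $\Gamma$: the labeled graph with vertex set $S$ in which two vertices $s,t$ are joined by an edge if $m_{s,t}\ge 3$ (including $m_{s,t}=\infty$), this edge being labeled by $m_{s,t}$ if $m_{s,t}\ge 4$. All Coxeter graphs have finite vertex set. For two letters $a,b$ and an integer $m\ge 2$, set $\Pi(a,b:m)=(ab)^{m/2}$ if $m$ is even and $\Pi(a,b:m)=(ab)^{(m-1)/2}a$ if $m$ is odd. Let $\Sigma=\{\sigma_s ; s\in S\}$ be a set in one-to-one correspondence with $S$. The Artin-Tits group of type $\Gamma$ is $$A_\Gamma=\langle \Sigma \mid \Pi(\sigma_s,\sigma_t:m_{s,t})=\Pi(\sigma_t,\sigma_s:m_{s,t}) \text{ for } s,t\in S,\ s\neq t,\ m_{s,t}\neq\infty\rangle.$$ A Coxeter graph $\Gamma$ is called free of infinity if $m_{s,t}\neq\infty$ for all $s,t\in S$, $s\neq t$. A group $G$ generated by a finite set $T$ has a solution to the word problem if there is an algorithm which, given a word $w$ in the free monoid $(T\sqcup T^{-1})^\ast$, decides whether $w$ represents the identity of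 $G$ (this does not depend on the choice of the finite generating set; for $A_\Gamma$ one may take $T=\Sigma$). *)

theory Defs
  imports "HOL-Algebra.Generated_Groups" "HOL-Library.Nat_Bijection" "HOL-Library.Extended_Nat"
begin

section \<open>Total recursive functions\<close>

text \<open>
  The total recursive functions of arity \<open>n\<close>: the least class containing the zero functions,
  the successor and the projections, and closed under composition, primitive recursion and
  minimization of regular functions. Only the values on lists of length \<open>n\<close> are meaningful.
\<close>

inductive recursive :: "nat \<Rightarrow> (nat list \<Rightarrow> nat) \<Rightarrow> bool" where
  recursive_zero: "recursive n (\<lambda>xs. 0)"
| recursive_succ: "recursive 1 (\<lambda>xs. Suc (hd xs))"
| recursive_proj: "i < n \<Longrightarrow> recursive n (\<lambda>xs. xs ! i)"
| recursive_comp: "recursive (length gs) f \<Longrightarrow> \<forall>g\<in>set gs. recursive n g \<Longrightarrow>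
    recursive n (\<lambda>xs. f (map (\<lambda>g. g xs) gs))"
| recursive_prec: "recursive n f \<Longrightarrow> recursive (Suc (Suc n)) g \<Longrightarrow>
    recursive (Suc n) (\<lambda>xs. rec_nat (f (tl xs)) (\<lambda>k r. g (k # r # tl xs)) (hd xs))"
| recursive_mu: "recursive (Suc n) f \<Longrightarrow> (\<forall>xs. length xs = n \<longrightarrow> (\<exists>y. f (y # xs) = 0)) \<Longrightarrow>
    recursive n (\<lambda>xs. LEAST y. f (y # xs) = 0)"


section \<open>Words and the word problem\<close>

text \<open>The letter \<open>(x, True)\<close> stands for \<open>x\<close>, and \<open>(x, False)\<close> for its formal inverse.\<close>

type_synonym 'a word = "('a \<times> bool) list"

definition words :: "'a set \<Rightarrow> 'a word set" where
  "words X = lists (X \<times> UNIV)"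

primrec word_value :: "('g, 'm) monoid_scheme \<Rightarrow> 'g word \<Rightarrow> 'g" where
  "word_value G [] = \<one>\<^bsub>G\<^esub>"
| "word_value G (l # w) =
    (if snd l then fst l else inv\<^bsub>G\<^esub> (fst l)) \<otimes>\<^bsub>G\<^esub> word_value G w"

text \<open>
  The group \<open>G\<close> is meant to be generated by the finite set \<open>T\<close>. Words are passed to the
  algorithm through a numbering of the finitely many letters; which numbering is used is
  immaterial, since any two differ by a finite table.
\<close>

definition solvable_word_problem :: "('g, 'm) monoid_scheme \<Rightarrow> 'g set \<Rightarrow> bool" where
  "solvable_word_problem G T \<longleftrightarrow>
    (\<exists>code :: 'g \<times> bool \<Rightarrow> nat. inj_on code (T \<times> UNIV) \<and>
      (\<exists>f. recursive 1 f \<and>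
        (\<forall>w\<in>words T. f [list_encode (map code w)] = (if word_value G w = \<one>\<^bsub>G\<^esub> then 1 else 0))))"


section \<open>Groups given by generators and relations\<close>

text \<open>
  The group \<open>\<langle>X | u = v for (u, v) \<in> R\<rangle>\<close> is the quotient of the free monoid on the letters
  \<open>x\<close>, \<open>x\<^sup>-\<^sup>1\<close> (\<open>x \<in> X\<close>) by the congruence generated by \<open>R\<close> and the free cancellations.
\<close>

inductive pres_eq :: "'a set \<Rightarrow> ('a word \<times> 'a word) set \<Rightarrow> 'a word \<Rightarrow> 'a word \<Rightarrow> bool"
  for X R where
  pres_eq_refl: "w \<in> words X \<Longrightarrow> pres_eq X R w w"
| pres_eq_sym: "pres_eq X R u v \<Longrightarrow> pres_eq X R v u"
| pres_eq_trans: "pres_eq X R u v \<Longrightarrow> pres_eq X R v w \<Longrightarrow> pres_eq X R u w"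
| pres_eq_cancel: "u \<in> words X \<Longrightarrow> v \<in> words X \<Longrightarrow> x \<in> X \<Longrightarrow>
    pres_eq X R (u @ [(x, b), (x, \<not> b)] @ v) (u @ v)"
| pres_eq_rel: "(l, r) \<in> R \<Longrightarrow> l \<in> words X \<Longrightarrow> r \<in> words X \<Longrightarrow> u \<in> words X \<Longrightarrow> v \<in> words X \<Longrightarrow>
    pres_eq X R (u @ l @ v) (u @ r @ v)"

definition pres_class :: "'a set \<Rightarrow> ('a word \<times> 'a word) set \<Rightarrow> 'a word \<Rightarrow> 'a word set" where
  "pres_class X R w = {v. pres_eq X R w v}"

definition presented_group :: "'a set \<Rightarrow> ('a word \<times> 'a word) set \<Rightarrow> 'a word set monoid" where
  "presented_group X R =
    \<lparr>carrier = pres_class X R ` words X,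
     mult = (\<lambda>A B. \<Union>u\<in>A. \<Union>v\<in>B. pres_class X R (u @ v)),
     one = pres_class X R []\<rparr>"

lemma words_Nil [simp]: "[] \<in> words X"
  by (simp add: words_def)

lemma words_Cons [simp]: "l # w \<in> words X \<longleftrightarrow> fst l \<in> X \<and> w \<in> words X"
  by (cases l) (auto simp: words_def)

lemma words_append [simp]: "u @ v \<in> words X \<longleftrightarrow> u \<in> words X \<and> v \<in> words X"
  by (auto simp: words_def)

lemma pres_eq_words: "pres_eq X R u v \<Longrightarrow> u \<in> words X \<and> v \<in> words X"
  by (induction rule: pres_eq.induct) auto

lemma pres_eq_append_left:
  "pres_eq X R u v \<Longrightarrow> w \<in> words X \<Longrightarrow> pres_eq X R (w @ u) (w @ v)"
proof (induction rule: pres_eq.induct)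
  case (pres_eq_cancel u v x b)
  then show ?case using pres_eq.pres_eq_cancel[of "w @ u" X v x R b] by simp
next
  case (pres_eq_rel l r u v)
  then show ?case using pres_eq.pres_eq_rel[of l r R X "w @ u" v] by simp
next
  case (pres_eq_trans u v x)
  then show ?case by (metis pres_eq.pres_eq_trans)
qed (simp_all add: pres_eq.pres_eq_refl pres_eq.pres_eq_sym)

lemma pres_eq_append_right:
  "pres_eq X R u v \<Longrightarrow> w \<in> words X \<Longrightarrow> pres_eq X R (u @ w) (v @ w)"
proof (induction rule: pres_eq.induct)
  case (pres_eq_cancel u v x b)
  then show ?case using pres_eq.pres_eq_cancel[of u X "v @ w" x R b] by simp
next
  case (pres_eq_rel l r u v)
  then show ?case using pres_eq.pres_eq_rel[of l r R X u "v @ w"] by simp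
next
  case (pres_eq_trans u v x)
  then show ?case by (metis pres_eq.pres_eq_trans)
qed (simp_all add: pres_eq.pres_eq_refl pres_eq.pres_eq_sym)

lemma pres_eq_append:
  "pres_eq X R u u' \<Longrightarrow> pres_eq X R v v' \<Longrightarrow> pres_eq X R (u @ v) (u' @ v')"
  using pres_eq_trans[OF pres_eq_append_right[of X R u u' v] pres_eq_append_left[of X R v v' u']]
    pres_eq_words[of X R u u'] pres_eq_words[of X R v v'] by simp

lemma pres_class_eq_iff:
  assumes "v \<in> words X"
  shows "pres_class X R u = pres_class X R v \<longleftrightarrow> pres_eq X R u v"
proof
  assume "pres_class X R u = pres_class X R v"
  then show "pres_eq X R u v"
    using pres_eq_refl[OF assms, of R] by (simp add: pres_class_def set_eq_iff)
next
  assume uv: "pres_eq X R u v"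
  have "pres_eq X R u w \<longleftrightarrow> pres_eq X R v w" for w
    using pres_eq_trans[OF uv] pres_eq_trans[OF pres_eq_sym[OF uv]] by metis
  then show "pres_class X R u = pres_class X R v"
    by (simp add: pres_class_def)
qed

lemma pres_mult:
  assumes "u \<in> words X" "v \<in> words X"
  shows "pres_class X R u \<otimes>\<^bsub>presented_group X R\<^esub> pres_class X R v = pres_class X R (u @ v)"
proof -
  have *: "pres_class X R (u' @ v') = pres_class X R (u @ v)"
    if "u' \<in> pres_class X R u" "v' \<in> pres_class X R v" for u' v'
  proof -
    have "pres_eq X R (u @ v) (u' @ v')"
      using that by (simp add: pres_class_def pres_eq_append)
    then show ?thesis
      using pres_class_eq_iff[of "u' @ v'" X R "u @ v"] pres_eq_words by metis
  qed
  have "(\<Union>u'\<in>pres_class X R u. \<Union>v'\<in>pres_class X R v. pres_class X R (u' @ v')) =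
      (\<Union>u'\<in>pres_class X R u. \<Union>v'\<in>pres_class X R v. pres_class X R (u @ v))"
    by (rule SUP_cong[OF refl], rule SUP_cong[OF refl], rule *)
  moreover have "pres_class X R u \<noteq> {}" "pres_class X R v \<noteq> {}"
    using pres_eq_refl[OF assms(1), of R] pres_eq_refl[OF assms(2), of R]
    unfolding pres_class_def by blast+
  ultimately show ?thesis
    by (simp add: presented_group_def)
qed

definition word_inverse :: "'a word \<Rightarrow> 'a word" where
  "word_inverse w = rev (map (\<lambda>(x, b). (x, \<not> b)) w)"

lemma word_inverse_words [simp]: "word_inverse w \<in> words X \<longleftrightarrow> w \<in> words X"
  by (induction w) (auto simp: word_inverse_def)

lemma pres_eq_word_inverse: "w \<in> words X \<Longrightarrow> pres_eq X R (word_inverse w @ w) []"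
proof (induction w)
  case Nil
  then show ?case by (simp add: word_inverse_def pres_eq_refl)
next
  case (Cons l w)
  obtain x b where l: "l = (x, b)" by (cases l)
  have "pres_eq X R (word_inverse w @ [(x, \<not> b), (x, \<not> \<not> b)] @ w) (word_inverse w @ w)"
    using Cons.prems l by (intro pres_eq_cancel) auto
  then have "pres_eq X R (word_inverse w @ [(x, \<not> b), (x, \<not> \<not> b)] @ w) []"
    by (rule pres_eq_trans) (use Cons in simp)
  then show ?case by (simp add: l word_inverse_def)
qed

lemma carrier_presented_group: "carrier (presented_group X R) = pres_class X R ` words X"
  by (simp add: presented_group_def)

lemma one_presented_group: "\<one>\<^bsub>presented_group X R\<^esub> = pres_class X R []"
  by (simp add: presented_group_def)

lemma group_presented_group: "group (presented_group X R)"
proof (rule groupI)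
  fix A assume "A \<in> carrier (presented_group X R)"
  then obtain u where u: "u \<in> words X" "A = pres_class X R u"
    by (auto simp: carrier_presented_group)
  then have "pres_class X R (word_inverse u) \<otimes>\<^bsub>presented_group X R\<^esub> A = \<one>\<^bsub>presented_group X R\<^esub>"
    by (simp add: pres_mult one_presented_group pres_class_eq_iff pres_eq_word_inverse)
  then show "\<exists>B\<in>carrier (presented_group X R). B \<otimes>\<^bsub>presented_group X R\<^esub> A = \<one>\<^bsub>presented_group X R\<^esub>"
    using u by (auto simp: carrier_presented_group)
qed (auto simp: carrier_presented_group one_presented_group pres_mult)

definition pres_gen :: "'a set \<Rightarrow> ('a word \<times> 'a word) set \<Rightarrow> 'a \<Rightarrow> 'a word set" where
  "pres_gen X R x = pres_class X R [(x, True)]"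

lemma inv_pres_gen:
  assumes "x \<in> X"
  shows "inv\<^bsub>presented_group X R\<^esub> (pres_gen X R x) = pres_class X R [(x, False)]"
proof -
  interpret group "presented_group X R" by (rule group_presented_group)
  have "pres_eq X R ([] @ [(x, False), (x, \<not> False)] @ []) ([] @ [])"
    using assms by (intro pres_eq_cancel) auto
  then show ?thesis
    using assms
    by (intro inv_equality)
      (auto simp: pres_gen_def pres_mult one_presented_group pres_class_eq_iff carrier_presented_group)
qed

lemma generate_pres_gen:
  "generate (presented_group X R) (pres_gen X R ` X) = carrier (presented_group X R)"
proof
  interpret group "presented_group X R" by (rule group_presented_group)
  show "generate (presented_group X R) (pres_gen X R ` X) \<subseteq> carrier (presented_group X R)"
    by (rule generate_incl) (auto simp: pres_gen_def carrier_presented_group)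
  have "pres_class X R w \<in> generate (presented_group X R) (pres_gen X R ` X)"
    if "w \<in> words X" for w
    using that
  proof (induction w)
    case Nil
    then show ?case using generate.one[of "presented_group X R"] by (simp add: one_presented_group)
  next
    case (Cons l w)
    obtain x b where l: "l = (x, b)" by (cases l)
    with Cons.prems have x: "x \<in> X" by simp
    have "pres_class X R [l] \<in> generate (presented_group X R) (pres_gen X R ` X)"
    proof (cases b)
      case True
      then show ?thesis using x l by (auto simp: pres_gen_def intro: generate.incl)
    next
      case False
      then show ?thesis
        using generate.inv[of "pres_gen X R x" "pres_gen X R ` X" "presented_group X R"] x l
        by (simp add: inv_pres_gen)
    qed
    from generate.eng[OF this Cons.IH] show ?case
      using Cons.prems by (simp add: pres_mult)
  qed
  then show "carrier (presented_group X R) \<subseteq> generate (presented_group X R) (pres_gen X R ` X)"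
    by (auto simp: carrier_presented_group)
qed


section \<open>Artin-Tits groups\<close>

text \<open>
  A Coxeter graph with vertex set \<open>S\<close> is represented by its Coxeter matrix; entries of \<open>m\<close>
  outside \<open>S \<times> S\<close> play no role.
\<close>

definition coxeter_matrix :: "'v set \<Rightarrow> ('v \<Rightarrow> 'v \<Rightarrow> enat) \<Rightarrow> bool" where
  "coxeter_matrix S m \<longleftrightarrow> finite S \<and> (\<forall>s\<in>S. m s s = 1) \<and>
    (\<forall>s\<in>S. \<forall>t\<in>S. s \<noteq> t \<longrightarrow> m s t = m t s \<and> 2 \<le> m s t)"

definition free_of_infinity :: "'v set \<Rightarrow> ('v \<Rightarrow> 'v \<Rightarrow> enat) \<Rightarrow> bool" where
  "free_of_infinity S m \<longleftrightarrow> (\<forall>s\<in>S. \<forall>t\<in>S. s \<noteq> t \<longrightarrow> m s t \<noteq> \<infinity>)"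

definition alternating :: "'a \<Rightarrow> 'a \<Rightarrow> nat \<Rightarrow> 'a list" where
  "alternating a b k = concat (replicate (k div 2) [a, b]) @ (if even k then [] else [a])"

definition artin_relations :: "'v set \<Rightarrow> ('v \<Rightarrow> 'v \<Rightarrow> enat) \<Rightarrow> ('v word \<times> 'v word) set" where
  "artin_relations S m =
    {(alternating (s, True) (t, True) k, alternating (t, True) (s, True) k) | s t k.
      s \<in> S \<and> t \<in> S \<and> s \<noteq> t \<and> m s t = enat k}"

definition artin_group :: "'v set \<Rightarrow> ('v \<Rightarrow> 'v \<Rightarrow> enat) \<Rightarrow> 'v word set monoid" where
  "artin_group S m = presented_group S (artin_relations S m)"

definition artin_generators :: "'v set \<Rightarrow> ('v \<Rightarrow> 'v \<Rightarrow> enat) \<Rightarrow> 'v word set set" where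
  "artin_generators S m = pres_gen S (artin_relations S m) ` S"

lemma group_artin_group: "group (artin_group S m)"
  by (simp add: artin_group_def group_presented_group)

lemma generate_artin_generators:
  "generate (artin_group S m) (artin_generators S m) = carrier (artin_group S m)"
  by (simp add: artin_group_def artin_generators_def generate_pres_gen)

end

theory Submission
  imports Defs Complex_Main
begin

text \<open>
A defining relation of \<open>A\<^sub>S\<close> involves two generators whose label is finite. If \<open>m s t = \<infinity>\<close>, every
relation therefore lives in \<open>A\<^bsub>S - {s}\<^esub>\<close> or in \<open>A\<^bsub>S - {t}\<^esub>\<close>, and \<open>A\<^sub>S\<close> is the pushout of these two
groups over \<open>A\<^sub>X\<close> with \<open>X = S - {s, t}\<close>. By induction on the number of generators both have a
solvable word problem. An amalgamated product inherits solvability as soon as the amalgamated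
subgroup embeds in both factors and membership in it can be decided there.

Both requirements come from one map (\<open>artin_retraction\<close>): for \<open>X \<subseteq> S\<close> there is a map from words
over \<open>S\<close> to words over \<open>X\<close> that respects equality in the groups, fixes the words over \<open>X\<close> and does
not increase length. Hence \<open>A\<^sub>X\<close> embeds in \<open>A\<^sub>S\<close>, and an element of \<open>A\<^sub>X\<close> that is represented by a
word of length \<open>n\<close> over \<open>S\<close> is also represented by a word of length at most \<open>n\<close> over \<open>X\<close>.
Membership is thus a finite search with the solution of the word problem of \<open>A\<^sub>S\<close> as the test; the
algorithm never computes in a Coxeter group, only the proof of its correctness does.

The retraction is the output of a transducer. Its states are the minimal representatives \<open>q\<close> of the
cosets \<open>W\<^sub>X q\<close> in the Coxeter group \<open>W\<close>. For a minimal \<open>q\<close> and a generator \<open>s\<close>, either \<open>q s\<close> is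
minimal again (the transducer moves there silently), or \<open>q s = x q\<close> for a unique \<open>x \<in> X\<close> (it stays
and emits \<open>x\<close> with the sign of the letter read). That reading the two sides of a braid relation
emits words that are equal in \<open>A\<^sub>X\<close> is \<open>transduce_braid\<close>. It uses the exchange condition, which is
derived from a parity invariant of reflections, and the fact that \<open>s t\<close> has order exactly \<open>m s t\<close>
in \<open>W\<close>, which is read off from the geometric representation in the form of the numbers game.

The normal form theorem for amalgams (\<open>reduced_product_nontrivial\<close>) is proved by letting the pushout
act on sequences of coset representatives. It yields the algorithm: repeatedly replace a factor
that is a word of one side, is not a word over \<open>X\<close>, but represents an element of \<open>A\<^sub>X\<close>, by a word
over \<open>X\<close> that is not longer. When this stops, a trivial word is a word of one of the two sides
(\<open>trivial_word_cases\<close>), where the induction hypothesis decides.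
\<close>

section \<open>Alternating words\<close>

text \<open>
Same words as \<open>alternating\<close>, but generated letter by letter, so that induction and splitting at
arbitrary positions are available.
\<close>

fun alt :: "'a \<Rightarrow> 'a \<Rightarrow> nat \<Rightarrow> 'a list" where
  "alt a b 0 = []"
| "alt a b (Suc k) = a # alt b a k"

lemma alternating_eq_alt: "alternating a b k = alt a b k"
proof (induction k rule: induct_nat_012)
  case (ge2 n)
  have "alternating a b (Suc (Suc n)) = a # b # alternating a b n"
    by (simp add: alternating_def)
  with ge2 show ?case by simp
qed (simp_all add: alternating_def)

lemma length_alt [simp]: "length (alt a b k) = k"
  by (induction k arbitrary: a b) auto

lemma set_alt: "set (alt a b k) \<subseteq> {a, b}"
proof (induction k arbitrary: a b)
  case (Suc k)
  show ?case using Suc[of b a] by auto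
qed simp

lemma map_alt: "map f (alt a b k) = alt (f a) (f b) k"
  by (induction k arbitrary: a b) auto

lemma alt_add: "alt a b (j + k) = alt a b j @ (if even j then alt a b k else alt b a k)"
  by (induction j arbitrary: a b) auto

lemma alt_Suc_snoc: "alt a b (Suc k) = alt a b k @ [if even k then a else b]"
  using alt_add[of a b k 1] by (auto split: if_splits)

lemma rev_alt: "rev (alt a b k) = (if even k then alt b a k else alt a b k)"
proof (induction k arbitrary: a b)
  case (Suc k)
  have "rev (alt a b (Suc k)) = (if even k then alt a b k else alt b a k) @ [a]"
    using Suc by simp
  also have "\<dots> = (if even (Suc k) then alt b a (Suc k) else alt a b (Suc k))"
    by (simp add: alt_Suc_snoc del: alt.simps)
  finally show ?case .
qed auto

section \<open>Words in a Coxeter group\<close>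

text \<open>
The Coxeter matrix is taken over a whole type: this avoids carrying a generating set through the
word combinatorics. A matrix on a subset extends by the label \<open>\<infinity>\<close>, which adds no relation.
\<close>

locale coxeter =
  fixes m :: "'a \<Rightarrow> 'a \<Rightarrow> enat"
  assumes m_sym: "m s t = m t s" and m_ge_2: "s \<noteq> t \<Longrightarrow> 2 \<le> m s t"
begin

text \<open>
Generators of a Coxeter group are involutions, so words need no signs, and reversal is inversion.
\<close>

inductive cox :: "'a list \<Rightarrow> 'a list \<Rightarrow> bool" (infix "\<approx>" 50) where
  cox_refl [simp, intro]: "u \<approx> u"
| cox_sym: "u \<approx> v \<Longrightarrow> v \<approx> u"
| cox_trans [trans]: "u \<approx> v \<Longrightarrow> v \<approx> w \<Longrightarrow> u \<approx> w"
| cox_square: "u @ [s, s] @ v \<approx> u @ v"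
| cox_braid: "s \<noteq> t \<Longrightarrow> m s t = enat k \<Longrightarrow> u @ alt s t k @ v \<approx> u @ alt t s k @ v"

lemma cox_append_left: "u \<approx> v \<Longrightarrow> w @ u \<approx> w @ v"
proof (induction rule: cox.induct)
  case (cox_square u s v)
  then show ?case using cox.cox_square[of "w @ u" s v] by simp
next
  case (cox_braid s t k u v)
  then show ?case using cox.cox_braid[of s t k "w @ u" v] by simp
qed (auto intro: cox_sym cox_trans)

lemma cox_append_right: "u \<approx> v \<Longrightarrow> u @ w \<approx> v @ w"
proof (induction rule: cox.induct)
  case (cox_square u s v)
  then show ?case using cox.cox_square[of u s "v @ w"] by simp
next
  case (cox_braid s t k u v)
  then show ?case using cox.cox_braid[of s t k u "v @ w"] by simp
qed (auto intro: cox_sym cox_trans)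

lemma cox_append: "u \<approx> u' \<Longrightarrow> v \<approx> v' \<Longrightarrow> u @ v \<approx> u' @ v'"
  using cox_append_left cox_append_right cox_trans by blast

lemma cox_Cons: "u \<approx> v \<Longrightarrow> s # u \<approx> s # v"
  using cox_append_left[of u v "[s]"] by simp

lemma cox_rev: "u \<approx> v \<Longrightarrow> rev u \<approx> rev v"
proof (induction rule: cox.induct)
  case (cox_square u s v)
  then show ?case using cox.cox_square[of "rev v" s "rev u"] by simp
next
  case (cox_braid s t k u v)
  then show ?case using cox.cox_braid[of s t k "rev v" "rev u"]
      cox_sym[OF cox.cox_braid[of s t k "rev v" "rev u"]] by (auto simp: rev_alt)
qed (auto intro: cox_sym cox_trans)

lemma cox_inv_right: "u @ rev u \<approx> []"
proof (induction u)
  case (Cons s u)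
  have "(s # u) @ rev (s # u) \<approx> [s] @ [] @ [s]"
    using cox_append[OF cox_refl[of "[s]"] cox_append_right[OF Cons, of "[s]"]] by simp
  also have "[s] @ [] @ [s] \<approx> []" using cox_square[of "[]" s "[]"] by simp
  finally show ?case .
qed simp

lemma cox_inv_left: "rev u @ u \<approx> []"
  using cox_inv_right[of "rev u"] by simp

text \<open>
Solving for a factor of an equation; together with \<open>cox_move_right\<close> this replaces cancellation
of inverses in all later calculations.
\<close>

lemma cox_move_left: "u @ v \<approx> w \<longleftrightarrow> v \<approx> rev u @ w"
proof
  assume "u @ v \<approx> w"
  then have "rev u @ u @ v \<approx> rev u @ w" by (rule cox_append_left)
  moreover have "v \<approx> rev u @ u @ v" using cox_sym[OF cox_append_right[OF cox_inv_left, of u v]] by simp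
  ultimately show "v \<approx> rev u @ w" by (rule cox_trans[rotated])
next
  assume "v \<approx> rev u @ w"
  then have "u @ v \<approx> u @ rev u @ w" by (rule cox_append_left)
  moreover have "u @ rev u @ w \<approx> w" using cox_append_right[OF cox_inv_right, of u w] by simp
  ultimately show "u @ v \<approx> w" by (rule cox_trans)
qed

lemma cox_rev_iff: "rev u \<approx> rev v \<longleftrightarrow> u \<approx> v"
  using cox_rev[of u v] cox_rev[of "rev u" "rev v"] by auto

lemma cox_move_right: "v @ u \<approx> w \<longleftrightarrow> v \<approx> w @ rev u"
  using cox_move_left[of "rev u" "rev v" "rev w"] by (metis cox_rev_iff rev_append rev_rev_ident)

lemma cox_move_Cons: "s # v \<approx> w \<longleftrightarrow> v \<approx> s # w"
  using cox_move_left[of "[s]" v w] by simp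

lemma cox_move_snoc: "v @ [s] \<approx> w \<longleftrightarrow> v \<approx> w @ [s]"
  using cox_move_right[of v "[s]" w] by simp

lemma cox_cong: "u \<approx> u' \<Longrightarrow> v \<approx> v' \<Longrightarrow> u \<approx> v \<longleftrightarrow> u' \<approx> v'"
  by (meson cox_sym cox_trans)

lemma cox_cancel_left: "u @ v \<approx> u @ w \<longleftrightarrow> v \<approx> w"
proof -
  have *: "rev u @ u @ w \<approx> w" using cox_append_right[OF cox_inv_left, of u w] by simp
  show ?thesis using cox_cong[OF cox_refl *] cox_move_left by blast
qed

lemma cox_cancel_right: "v @ u \<approx> w @ u \<longleftrightarrow> v \<approx> w"
  using cox_cancel_left[of "rev u" "rev v" "rev w"] by (metis cox_rev_iff rev_append)

lemma cox_cancel_Cons: "s # v \<approx> s # w \<longleftrightarrow> v \<approx> w"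
  using cox_cancel_left[of "[s]"] by simp

lemma cox_square_Cons: "s # s # v \<approx> v"
  using cox_square[of "[]" s v] by simp

lemma cox_even_length: "u \<approx> v \<Longrightarrow> even (length u) \<longleftrightarrow> even (length v)"
  by (induction rule: cox.induct) auto

section \<open>Reflections and the exchange condition\<close>

text \<open>
The word \<open>s\<^sub>1 \<dots> s\<^sub>n\<close> crosses the reflections \<open>s\<^sub>1 \<dots> s\<^sub>i\<^sub>-\<^sub>1 s\<^sub>i s\<^sub>i\<^sub>-\<^sub>1 \<dots> s\<^sub>1\<close>, namely the walls met by the
corresponding path of chambers; the function counts how often the wall of \<open>r\<close> is crossed.
\<close>

primrec refl_count :: "'a list \<Rightarrow> 'a list \<Rightarrow> nat" where
  "refl_count [] r = 0"
| "refl_count (s # w) r = (if [s] \<approx> r then 1 else 0) + refl_count w (s # r @ [s])"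

lemma refl_count_append: "refl_count (u @ v) r = refl_count u r + refl_count v (rev u @ r @ u)"
  by (induction u arbitrary: r) auto

lemma refl_count_cong: "r \<approx> r' \<Longrightarrow> refl_count w r = refl_count w r'"
proof (induction w arbitrary: r r')
  case (Cons s w)
  have "s # r @ [s] \<approx> s # r' @ [s]"
    using Cons.prems by (intro cox_Cons cox_append_right)
  moreover have "[s] \<approx> r \<longleftrightarrow> [s] \<approx> r'"
    using Cons.prems by (intro cox_cong) auto
  ultimately show ?case using Cons.IH[of "s # r @ [s]" "s # r' @ [s]"] by simp
qed simp

lemma refl_count_alt:
  "refl_count (alt s t k) r = (\<Sum>i<k. if alt s t (2 * i + 1) \<approx> r then 1 else 0)"
proof (induction k arbitrary: s t r)
  case (Suc k)
  have *: "alt t s (2 * i + 1) \<approx> s # r @ [s] \<longleftrightarrow> alt s t (2 * Suc i + 1) \<approx> r" for i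
  proof -
    have "2 * Suc i + 1 = Suc (Suc (2 * i + 1))" by simp
    then have "alt s t (2 * Suc i + 1) = s # alt t s (Suc (2 * i + 1))"
      by (simp only: alt.simps)
    then have "alt s t (2 * Suc i + 1) = s # alt t s (2 * i + 1) @ [s]"
      by (simp only: alt_Suc_snoc) simp
    then show ?thesis
      by (metis append_Cons cox_move_Cons cox_move_snoc)
  qed
  have "(\<Sum>i<Suc k. if alt s t (2 * i + 1) \<approx> r then 1 else 0 :: nat) =
     (if [s] \<approx> r then 1 else 0) + (\<Sum>i<k. if alt s t (2 * Suc i + 1) \<approx> r then 1 else 0)"
    by (subst sum.lessThan_Suc_shift) simp
  also have "\<dots> = refl_count (alt s t (Suc k)) r"
    using Suc[of t s "s # r @ [s]"] by (simp only: * alt.simps refl_count.simps)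
  finally show ?case by simp
qed simp

text \<open>
Both sides of a braid relation cross the same walls, in opposite order: the wall number \<open>i\<close> of one
side is the wall number \<open>k - 1 - i\<close> of the other. The equality of the counts themselves, and not
only of their parities, is what \<open>transduce_braid\<close> relies on.
\<close>

lemma refl_count_braid:
  assumes "s \<noteq> t" "m s t = enat k"
  shows "refl_count (alt s t k) r = refl_count (alt t s k) r"
proof -
  have st: "alt s t k \<approx> alt t s k"
    using cox_braid[OF assms, of "[]" "[]"] by simp
  have *: "alt s t (2 * i + 1) \<approx> alt t s (2 * j + 1)" if "i + j + 1 = k" for i j
  proof -
    have "(2 * i + 1) + (2 * j + 1) = k + k" using that by simp
    then have "alt s t (2 * i + 1) @ rev (alt t s (2 * j + 1)) = alt s t k @ rev (alt t s k)"
      using alt_add[of s t "2 * i + 1" "2 * j + 1"] alt_add[of s t k k]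
      by (simp add: rev_alt del: alt.simps)
    also have "\<dots> \<approx> alt t s k @ rev (alt t s k)" using st by (rule cox_append_right)
    also have "\<dots> \<approx> []" by (rule cox_inv_right)
    finally show ?thesis
      unfolding cox_move_right by simp
  qed
  have "(\<Sum>i<k. if alt s t (2 * i + 1) \<approx> r then 1 else 0 :: nat) =
      (\<Sum>i<k. if alt s t (2 * (k - Suc i) + 1) \<approx> r then 1 else 0)"
    by (rule sum.nat_diff_reindex[symmetric])
  also have "\<dots> = (\<Sum>i<k. if alt t s (2 * i + 1) \<approx> r then 1 else 0)"
  proof (rule sum.cong[OF refl])
    fix i assume "i \<in> {..<k}"
    then have "alt s t (2 * (k - Suc i) + 1) \<approx> alt t s (2 * i + 1)"
      by (intro *) auto
    then show "(if alt s t (2 * (k - Suc i) + 1) \<approx> r then 1 else 0 :: nat) =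
        (if alt t s (2 * i + 1) \<approx> r then 1 else 0)"
      using cox_cong[OF _ cox_refl[of r]] by presburger
  qed
  finally show ?thesis by (simp only: refl_count_alt)
qed

text \<open>
Two paths with the same ends cross a wall equally often modulo 2. This invariant detects
reflections without any geometric realization of the group.
\<close>

lemma refl_count_parity: "u \<approx> v \<Longrightarrow> even (refl_count u r) \<longleftrightarrow> even (refl_count v r)"
proof (induction arbitrary: r rule: cox.induct)
  case (cox_square u s v)
  have "[s] \<approx> s # (rev u @ r @ u) @ [s] \<longleftrightarrow> [s] \<approx> rev u @ r @ u"
    using cox_cancel_Cons[of s "[]" "(rev u @ r @ u) @ [s]"] cox_move_snoc[of "rev u @ r @ u" s "[]"]
    by (auto intro: cox_sym)
  moreover have "refl_count v (s # s # (rev u @ r @ u) @ [s, s]) = refl_count v (rev u @ r @ u)"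
  proof (rule refl_count_cong)
    have "s # s # (rev u @ r @ u) @ [s, s] \<approx> (rev u @ r @ u) @ [s, s]" by (rule cox_square_Cons)
    also have "(rev u @ r @ u) @ [s, s] \<approx> rev u @ r @ u"
      using cox.cox_square[of "rev u @ r @ u" s "[]"] by simp
    finally show "s # s # (rev u @ r @ u) @ [s, s] \<approx> rev u @ r @ u" .
  qed
  ultimately show ?case by (simp add: refl_count_append)
next
  case (cox_braid s t k u v)
  have "refl_count v (rev (alt s t k) @ (rev u @ r @ u) @ alt s t k) =
      refl_count v (rev (alt t s k) @ (rev u @ r @ u) @ alt t s k)"
    using cox.cox_braid[OF cox_braid, of "[]" "[]"]
    by (intro refl_count_cong cox_append cox_rev) auto
  then show ?case
    by (simp add: refl_count_append refl_count_braid[OF cox_braid])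
qed (auto simp: refl_count_append)

definition ell :: "'a list \<Rightarrow> nat" where
  "ell w = (LEAST n. \<exists>v. v \<approx> w \<and> length v = n)"

lemma ell_le: "v \<approx> w \<Longrightarrow> ell w \<le> length v"
  unfolding ell_def by (rule Least_le) auto

lemma ell_obtain: obtains v where "v \<approx> w" "length v = ell w"
proof -
  have "\<exists>v. v \<approx> w \<and> length v = ell w"
    unfolding ell_def by (rule LeastI[of _ "length w"]) auto
  then show ?thesis using that by blast
qed

lemma ell_cong: "u \<approx> v \<Longrightarrow> ell u = ell v"
  by (metis cox_sym cox_trans ell_le ell_obtain le_antisym)

lemma even_ell: "even (ell w) \<longleftrightarrow> even (length w)"
  by (metis cox_even_length ell_obtain)

lemma ell_rev: "ell (rev w) = ell w"
proof -
  have *: "ell (rev w) \<le> ell w" for w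
    by (metis cox_rev ell_le ell_obtain length_rev)
  from *[of w] *[of "rev w"] show ?thesis by simp
qed

lemma ell_Cons_le: "ell (s # w) \<le> Suc (ell w)"
  by (metis cox_Cons ell_le ell_obtain length_Cons)

lemma ell_Cons_neq: "ell (s # w) \<noteq> ell w"
  using even_ell[of w] even_ell[of "s # w"] by auto

lemma ell_snoc_le: "ell (w @ [s]) \<le> Suc (ell w)"
  using ell_Cons_le[of s "rev w"] ell_rev[of w] ell_rev[of "w @ [s]"] by simp

text \<open>
Reflecting a path in a wall that it crosses folds it back at the crossing, which saves one letter.
\<close>

lemma refl_count_pos:
  "refl_count w r > 0 \<Longrightarrow> \<exists>w1 a w2. w = w1 @ a # w2 \<and> r @ w \<approx> w1 @ w2"
proof (induction w arbitrary: r)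
  case (Cons s w)
  show ?case
  proof (cases "[s] \<approx> r")
    case True
    have "r @ s # w \<approx> s # s # w"
      using cox_append_right[OF cox_sym[OF True], of "s # w"] by simp
    also have "\<dots> \<approx> w" by (rule cox_square_Cons)
    finally show ?thesis by (intro exI[of _ "[]"]) auto
  next
    case False
    with Cons.prems obtain w1 a w2 where w: "w = w1 @ a # w2" "s # r @ s # w \<approx> w1 @ w2"
      using Cons.IH[of "s # r @ [s]"] by auto
    then have "r @ s # w \<approx> (s # w1) @ w2" by (simp add: cox_move_Cons)
    then show ?thesis using w(1) by (metis append_Cons)
  qed
qed simp

text \<open>
If no wall of \<open>w\<close> is the wall of \<open>s\<close>, then \<open>s w\<close> crosses the wall of \<open>s\<close> exactly once, so every word
for \<open>s w\<close> crosses it; folding a shortest such word there gives a word for \<open>w\<close> that is too short.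
Hence \<open>w\<close> itself crosses the wall of \<open>s\<close> and can be folded there.
\<close>

lemma exchange:
  assumes red: "ell w = length w" and nonred: "ell (s # w) \<le> length w"
  shows "\<exists>w1 a w2. w = w1 @ a # w2 \<and> s # w \<approx> w1 @ w2"
proof -
  have sss: "s # [s] @ [s] \<approx> [s]" using cox_square_Cons[of s "[s]"] by simp
  show ?thesis
  proof (cases "refl_count w [s] > 0")
    case True
    then show ?thesis using refl_count_pos[of w "[s]"] by simp
  next
    case False
    obtain z where z: "z \<approx> s # w" "length z = ell (s # w)" by (rule ell_obtain)
    \<comment> \<open>conjugation by \<open>s\<close> fixes the wall of \<open>s\<close>, so all further crossings would be those of \<open>w\<close>\<close>
    have "refl_count (s # w) [s] = 1"
      using False refl_count_cong[OF sss, of w] by simp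
    then have "odd (refl_count z [s])"
      using refl_count_parity[OF z(1), of "[s]"] by simp
    then have "refl_count z [s] > 0" by (rule odd_pos)
    then obtain z1 a z2 where z12: "z = z1 @ a # z2" "[s] @ z \<approx> z1 @ z2"
      using refl_count_pos by blast
    have "[s] @ z \<approx> w"
      using cox_move_Cons z(1) by simp
    then have "z1 @ z2 \<approx> w" using z12(2) cox_sym cox_trans by blast
    then have "ell w \<le> length (z1 @ z2)" by (rule ell_le)
    moreover have "length z = Suc (length (z1 @ z2))" using z12(1) by simp
    ultimately have "ell w < length z" by simp
    then show ?thesis using red nonred z(2) by simp
  qed
qed

lemma exchange_right:
  assumes "ell w = length w" and "ell (w @ [s]) \<le> length w"
  shows "\<exists>w1 a w2. w = w1 @ a # w2 \<and> w @ [s] \<approx> w1 @ w2"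
proof -
  have "\<exists>w1 a w2. rev w = w1 @ a # w2 \<and> s # rev w \<approx> w1 @ w2"
    using assms ell_rev[of w] ell_rev[of "w @ [s]"] by (intro exchange) auto
  then obtain w1 a w2 where *: "rev w = w1 @ a # w2" "s # rev w \<approx> w1 @ w2" by auto
  have "w = rev w2 @ a # rev w1"
    using arg_cong[OF *(1), of rev] by simp
  moreover have "w @ [s] \<approx> rev w2 @ rev w1"
    using cox_rev[OF *(2)] by simp
  ultimately show ?thesis by blast
qed

section \<open>Shortest elements of cosets of a dihedral subgroup\<close>

text \<open>
\<open>v\<close> is shortest in its coset \<open>v \<langle>s, t\<rangle>\<close>. The formulation bounds the length of words instead of the
length of elements, so that it also says that \<open>v\<close> is a reduced word.
\<close>

definition coset_min :: "'a \<Rightarrow> 'a \<Rightarrow> 'a list \<Rightarrow> bool" where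
  "coset_min s t v \<longleftrightarrow> (\<forall>v' d. v \<approx> v' @ d \<longrightarrow> set d \<subseteq> {s, t} \<longrightarrow> length v \<le> length v')"

text \<open>
When a letter appended to \<open>v e\<close> shortens it, the exchange condition deletes a letter. It cannot be
in \<open>v\<close>, since that would give a shorter element of the coset, and not in \<open>e\<close>, which is shortest
among the words in \<open>s\<close> and \<open>t\<close>.
\<close>

lemma ell_coset_min_append:
  assumes v: "coset_min s t v" and "set e \<subseteq> {s, t}"
    and "\<forall>e'. e' \<approx> e \<longrightarrow> set e' \<subseteq> {s, t} \<longrightarrow> length e \<le> length e'"
  shows "ell (v @ e) = length v + length e"
  using assms(2,3)
proof (induction e rule: rev_induct)
  case Nil
  obtain v' where v': "v' \<approx> v" "length v' = ell v" by (rule ell_obtain)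
  then have "length v \<le> length v'"
    using v[unfolded coset_min_def, rule_format, of v' "[]"] cox_sym by auto
  then show ?case using v' ell_le[OF cox_refl, of v] by simp
next
  case (snoc b e)
  have min: "length e \<le> length e'" if "e' \<approx> e" "set e' \<subseteq> {s, t}" for e'
    using snoc.prems(2)[rule_format, of "e' @ [b]"] that snoc.prems(1) cox_append_right by auto
  have red: "ell (v @ e) = length (v @ e)"
    using snoc.IH snoc.prems min by auto
  show ?case
  proof (rule ccontr)
    assume "ell (v @ e @ [b]) \<noteq> length v + length (e @ [b])"
    then have "ell ((v @ e) @ [b]) \<le> length (v @ e)"
      using ell_snoc_le[of "v @ e" b] red by simp
    from exchange_right[OF red this] obtain w1 a w2
      where w: "v @ e = w1 @ a # w2" "v @ e @ [b] \<approx> w1 @ w2" by auto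
    from w(1) have "(\<exists>z. v = w1 @ a # z \<and> w2 = z @ e) \<or> (\<exists>z. w1 = v @ z \<and> e = z @ a # w2)"
      unfolding append_eq_append_conv2 by (auto simp: append_eq_Cons_conv)
    then consider z where "v = w1 @ a # z" "w2 = z @ e" | z where "w1 = v @ z" "e = z @ a # w2"
      by blast
    then show False
    proof cases
      case 1
      have "v \<approx> (w1 @ z) @ (e @ rev (e @ [b]))"
        using w(2) 1 cox_move_right[of v "e @ [b]" "w1 @ w2"] by simp
      moreover have "set (e @ rev (e @ [b])) \<subseteq> {s, t}" using snoc.prems(1) by auto
      ultimately have "length v \<le> length (w1 @ z)"
        using v unfolding coset_min_def by blast
      then show ?thesis using 1 by simp
    next
      case 2
      then have "e @ [b] \<approx> z @ w2"
        using w(2) cox_cancel_left[of v "e @ [b]" "z @ w2"] by simp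
      then have "length (e @ [b]) \<le> length (z @ w2)"
        using snoc.prems(1) 2 by (intro snoc.prems(2)[rule_format, OF cox_sym]) auto
      then show ?thesis using 2 by simp
    qed
  qed
qed

text \<open>
Lengths add along \<open>v \<langle>s, t\<rangle>\<close>, and \<open>x v\<close> is at most one letter longer than \<open>v\<close>; so \<open>\<tau>\<close> has length
one. This is the part of the theory of double cosets that is needed here.
\<close>

lemma coset_min_reflection:
  assumes v: "coset_min s t v" and \<tau>: "set \<tau> \<subseteq> {s, t}" and eq: "x # v \<approx> v @ \<tau>"
  shows "\<tau> \<approx> [s] \<or> \<tau> \<approx> [t]"
proof -
  have "\<exists>e. (e \<approx> \<tau> \<and> set e \<subseteq> {s, t}) \<and> (\<forall>e'. e' \<approx> \<tau> \<and> set e' \<subseteq> {s, t} \<longrightarrow> length e \<le> length e')"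
    using \<tau> by (intro ex_has_least_nat[of _ \<tau>]) auto
  then obtain e where e: "e \<approx> \<tau>" "set e \<subseteq> {s, t}"
    and min: "\<And>e'. e' \<approx> \<tau> \<Longrightarrow> set e' \<subseteq> {s, t} \<Longrightarrow> length e \<le> length e'" by blast
  have "ell (v @ e) = length v + length e"
    using e by (intro ell_coset_min_append[OF v]) (auto intro: min cox_trans)
  moreover have "x # v \<approx> v @ e"
    using eq cox_append_left[OF cox_sym[OF e(1)], of v] cox_trans by blast
  ultimately have "length e \<le> 1" "odd (length e)"
    using ell_le[of "x # v" "v @ e"] cox_even_length[of "x # v" "v @ e"] by auto
  then obtain c where "e = [c]"
    by (cases e) auto
  then show ?thesis using e cox_sym by auto
qed

section \<open>The numbers game and the order of a product of two generators\<close>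

text \<open>
Firing \<open>s\<close> is the action of \<open>s\<close> on the dual of the geometric representation, in the coordinates
given by the simple roots. The weight \<open>1\<close> belongs to the label \<open>\<infinity>\<close>.
\<close>

definition weight :: "'a \<Rightarrow> 'a \<Rightarrow> real" where
  "weight s t = (case m s t of enat k \<Rightarrow> cos (pi / k) | \<infinity> \<Rightarrow> 1)"

definition fire :: "'a \<Rightarrow> ('a \<Rightarrow> real) \<Rightarrow> 'a \<Rightarrow> real" where
  "fire s x = (\<lambda>r. if r = s then - x s else x r + 2 * weight s r * x s)"

definition fires :: "'a list \<Rightarrow> ('a \<Rightarrow> real) \<Rightarrow> 'a \<Rightarrow> real" where
  "fires w = fold fire w"

lemma fires_simps [simp]: "fires [] x = x" "fires (s # w) x = fires w (fire s x)"
  "fires (u @ v) x = fires v (fires u x)"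
  by (simp_all add: fires_def)

lemma weight_sym: "weight s t = weight t s"
  by (simp add: weight_def m_sym)

text \<open>
Firing \<open>s\<close> and \<open>t\<close> in turn, the numbers that are fired satisfy a linear recurrence of order two:
after \<open>n\<close> steps the next letter carries \<open>g (n + 1)\<close> and the letter fired last carries \<open>- g n\<close>.
\<close>

lemma fires_alt:
  fixes g :: "nat \<Rightarrow> real"
  assumes "s \<noteq> t" "g 0 = - x t" "g 1 = x s" "\<And>n. g (Suc (Suc n)) = 2 * weight s t * g (Suc n) - g n"
  shows "(even n \<longrightarrow> fires (alt s t n) x s = g (Suc n) \<and> fires (alt s t n) x t = - g n) \<and>
         (odd n \<longrightarrow> fires (alt s t n) x t = g (Suc n) \<and> fires (alt s t n) x s = - g n)"
proof (induction n)
  case (Suc n)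
  then show ?case using assms(1) weight_sym[of s t]
    by (auto simp: alt_Suc_snoc assms(4) fire_def simp del: alt.simps)
qed (use assms in auto)

lemma sine_recurrence: "sin (((x::real) + 1) * \<theta>) = 2 * cos \<theta> * sin (x * \<theta>) - sin ((x - 1) * \<theta>)"
  by (simp add: distrib_right left_diff_distrib sin_add sin_diff)

text \<open>
For a finite label the recurrence is that of \<open>n \<mapsto> sin (n \<theta>)\<close> with \<open>\<theta> = pi / k\<close>.
\<close>

lemma fires_alt_finite:
  fixes x :: "'a \<Rightarrow> real"
  assumes "s \<noteq> t" "m s t = enat k"
  defines "\<theta> \<equiv> pi / k"
  defines "g \<equiv> \<lambda>n. (x s * sin (real n * \<theta>) + x t * sin ((real n - 1) * \<theta>)) / sin \<theta>"
  shows "(even n \<longrightarrow> fires (alt s t n) x s = g (Suc n) \<and> fires (alt s t n) x t = - g n) \<and>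
         (odd n \<longrightarrow> fires (alt s t n) x t = g (Suc n) \<and> fires (alt s t n) x s = - g n)"
    and "sin \<theta> > 0"
proof -
  have k: "k \<ge> 2" using m_ge_2[OF assms(1)] assms(2) by (simp add: numeral_eq_enat)
  have "0 < \<theta>" "\<theta> < pi" using k by (auto simp: \<theta>_def field_simps)
  then show pos: "sin \<theta> > 0" by (rule sin_gt_zero)
  have w: "weight s t = cos \<theta>" by (simp add: weight_def assms(2) \<theta>_def)
  have "g (Suc (Suc n)) = 2 * weight s t * g (Suc n) - g n" for n
  proof -
    have 1: "sin (real (Suc (Suc n)) * \<theta>) =
        2 * cos \<theta> * sin (real (Suc n) * \<theta>) - sin (real n * \<theta>)"
      using sine_recurrence[of "real n + 1" \<theta>] by (simp add: algebra_simps)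
    have 2: "sin ((real (Suc (Suc n)) - 1) * \<theta>) =
        2 * cos \<theta> * sin ((real (Suc n) - 1) * \<theta>) - sin ((real n - 1) * \<theta>)"
      using sine_recurrence[of "real n" \<theta>] by (simp add: algebra_simps)
    show ?thesis
      unfolding g_def w 1 2 using pos by (simp add: divide_simps) (simp add: algebra_simps)
  qed
  then show "(even n \<longrightarrow> fires (alt s t n) x s = g (Suc n) \<and> fires (alt s t n) x t = - g n) \<and>
         (odd n \<longrightarrow> fires (alt s t n) x t = g (Suc n) \<and> fires (alt s t n) x s = - g n)"
    using pos by (intro fires_alt assms(1)) (auto simp: g_def)
qed

lemma fires_braid_end:
  assumes "s \<noteq> t" "m s t = enat k"
  shows "fires (alt s t k) x s = (if even k then - x s else - x t)"
    and "fires (alt s t k) x t = (if even k then - x t else - x s)"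
proof -
  note f = fires_alt_finite(1)[OF assms, of k x]
  have k: "k \<ge> 2" using m_ge_2[OF assms(1)] assms(2) by (simp add: numeral_eq_enat)
  have "real k * (pi / k) = pi" "(real (Suc k) - 1) * (pi / k) = pi"
     "real (Suc k) * (pi / k) = pi / k + pi" "(real k - 1) * (pi / k) = pi - pi / k"
    using k by (simp_all add: field_simps)
  then have s: "sin (real k * (pi / k)) = 0" "sin ((real (Suc k) - 1) * (pi / k)) = 0"
     "sin (real (Suc k) * (pi / k)) = - sin (pi / k)"
     "sin ((real k - 1) * (pi / k)) = sin (pi / k)"
    by (simp_all only: sin_pi sin_periodic_pi sin_pi_minus)
  have "sin (pi / k) \<noteq> 0" using fires_alt_finite(2)[OF assms] by simp
  then show "fires (alt s t k) x s = (if even k then - x s else - x t)"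
    and "fires (alt s t k) x t = (if even k then - x t else - x s)"
    using f unfolding s by (cases "even k"; simp)+
qed

text \<open>
The other coordinates depend only on the total amounts \<open>P\<close> and \<open>Q\<close> fired at \<open>s\<close> and at \<open>t\<close>.
\<close>

lemma fires_linear:
  assumes "s \<noteq> t" "set w \<subseteq> {s, t}"
  shows "\<exists>P Q. fires w x s = x s - 2 * P + 2 * weight s t * Q \<and>
     fires w x t = x t - 2 * Q + 2 * weight s t * P \<and>
     (\<forall>r. r \<noteq> s \<longrightarrow> r \<noteq> t \<longrightarrow> fires w x r = x r + 2 * weight s r * P + 2 * weight t r * Q)"
  using assms(2)
proof (induction w rule: rev_induct)
  case Nil
  show ?case by (intro exI[of _ 0]) auto
next
  case (snoc c w)
  then obtain P Q where PQ: "fires w x s = x s - 2 * P + 2 * weight s t * Q"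
     "fires w x t = x t - 2 * Q + 2 * weight s t * P"
     "\<And>r. r \<noteq> s \<Longrightarrow> r \<noteq> t \<Longrightarrow> fires w x r = x r + 2 * weight s r * P + 2 * weight t r * Q"
    by auto
  show ?case
  proof (cases "c = s")
    case True
    then show ?thesis
      using PQ assms(1) by (intro exI[of _ "P + fires w x s"] exI[of _ Q]) (auto simp: fire_def algebra_simps)
  next
    case False
    then show ?thesis
      using PQ assms(1) snoc.prems weight_sym[of s t]
      by (intro exI[of _ P] exI[of _ "Q + fires w x t"]) (auto simp: fire_def algebra_simps)
  qed
qed

text \<open>
It suffices to compare the coordinates \<open>s\<close> and \<open>t\<close>: they determine the totals \<open>P\<close> and \<open>Q\<close>, because the
matrix of that linear system has the determinant \<open>1 - c\<^sup>2\<close> up to a constant, where \<open>c\<close> is a cosine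
different from \<open>1\<close> and \<open>-1\<close>.
\<close>

lemma fires_braid:
  assumes "s \<noteq> t" "m s t = enat k"
  shows "fires (alt s t k) x = fires (alt t s k) x"
proof -
  have k: "k \<ge> 2" using m_ge_2[OF assms(1)] assms(2) by (simp add: numeral_eq_enat)
  have sym: "t \<noteq> s" "m t s = enat k" using assms m_sym by auto
  define c where "c = weight s t"
  have "0 < pi / k" "pi / k < pi" using k by (auto simp: field_simps)
  then have "sin (pi / k) > 0" by (rule sin_gt_zero)
  then have "(sin (pi / k))\<^sup>2 > 0" by simp
  moreover have "c * c = 1 - (sin (pi / k))\<^sup>2"
    using cos_squared_eq[of "pi / k"] by (simp add: c_def weight_def assms(2) power2_eq_square[of "cos _"])
  ultimately have c: "1 - c * c \<noteq> 0" by simp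
  obtain P Q where PQ: "fires (alt s t k) x s = x s - 2 * P + 2 * c * Q"
     "fires (alt s t k) x t = x t - 2 * Q + 2 * c * P"
     "\<And>r. r \<noteq> s \<Longrightarrow> r \<noteq> t \<Longrightarrow> fires (alt s t k) x r = x r + 2 * weight s r * P + 2 * weight t r * Q"
    using fires_linear[OF assms(1) set_alt[of s t k], of x] unfolding c_def by blast
  obtain P' Q' where PQ': "fires (alt t s k) x s = x s - 2 * P' + 2 * c * Q'"
     "fires (alt t s k) x t = x t - 2 * Q' + 2 * c * P'"
     "\<And>r. r \<noteq> s \<Longrightarrow> r \<noteq> t \<Longrightarrow> fires (alt t s k) x r = x r + 2 * weight s r * P' + 2 * weight t r * Q'"
    using fires_linear[OF assms(1), of "alt t s k" x] set_alt[of t s k] unfolding c_def by blast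
  have st: "fires (alt s t k) x s = fires (alt t s k) x s" "fires (alt s t k) x t = fires (alt t s k) x t"
    using fires_braid_end[OF assms] fires_braid_end[OF sym] by auto
  have 1: "P - P' = c * (Q - Q')" "Q - Q' = c * (P - P')"
    using st PQ PQ' by (auto simp: algebra_simps)
  have "P - P' = c * (c * (P - P'))" using 1(1) unfolding 1(2) .
  moreover have "Q - Q' = c * (c * (Q - Q'))" using 1(2) unfolding 1(1) .
  ultimately have "(1 - c * c) * (P - P') = 0" "(1 - c * c) * (Q - Q') = 0"
    by (simp_all add: algebra_simps)
  then have "P = P'" "Q = Q'" using c by auto
  then show ?thesis
    using st PQ(3) PQ'(3) by (intro ext) metis
qed

lemma fires_cong: "u \<approx> v \<Longrightarrow> fires u x = fires v x"
proof (induction arbitrary: x rule: cox.induct)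
  case (cox_square u s v)
  have "fire s (fire s x) = x" for x
    by (auto simp: fire_def)
  then show ?case by simp
next
  case (cox_braid s t k u v)
  then show ?case by (simp add: fires_braid[OF cox_braid])
qed auto

lemma cox_single_inj: "[s] \<approx> [t] \<Longrightarrow> s = t"
  using fires_cong[of "[s]" "[t]" "\<lambda>r. if r = s then 1 else 0"]
  by (auto simp: fire_def fun_eq_iff split: if_splits)

text \<open>
The order of \<open>s t\<close> is not smaller than its label. Started at \<open>0\<close> on \<open>s\<close> and \<open>1\<close> on \<open>t\<close>, the numbers
fired are \<open>sin (n \<theta>) / sin \<theta>\<close>, or \<open>n\<close> for the label \<open>\<infinity>\<close>, and an equality of the two alternating
words of length \<open>n\<close> forces this number to vanish.
\<close>

lemma alt_eq_dvd:
  assumes "s \<noteq> t" "alt s t n \<approx> alt t s n" "n > 0"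
  shows "\<exists>k. m s t = enat k \<and> k dvd n"
proof -
  define x :: "'a \<Rightarrow> real" where "x = (\<lambda>r. if r = t then 1 else 0)"
  have eq: "fires (alt s t n) x = fires (alt t s n) x"
    by (rule fires_cong[OF assms(2)])
  have x: "x s = 0" "x t = 1" using assms(1) by (auto simp: x_def)
  show ?thesis
  proof (cases "m s t")
    case (enat k)
    then have enat': "m t s = enat k" by (simp add: m_sym)
    have k: "k \<ge> 2" using m_ge_2[OF assms(1)] enat by (simp add: numeral_eq_enat)
    have "sin (real n * (pi / k)) = 0"
      using fires_alt_finite[OF assms(1) enat]
        fires_alt_finite(1)[OF assms(1) enat, of n x]
        fires_alt_finite(1)[OF assms(1)[symmetric] enat', of n x] eq x
      by (cases "even n") (auto simp: field_simps)
    then obtain i :: int where "real n * (pi / k) = of_int i * pi"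
      unfolding sin_zero_iff_int2 by blast
    then have "real n = of_int i * real k" using k by (simp add: field_simps)
    then have "int n = i * int k" by (metis of_int_eq_iff of_int_mult of_int_of_nat_eq)
    then have "int k dvd int n" by simp
    then show ?thesis using enat by simp
  next
    case infinity
    then have w: "weight s t = 1" "weight t s = 1" by (auto simp: weight_def m_sym)
    have "even n \<longrightarrow> fires (alt s t n) x t = - (real n - 1)"
         "odd n \<longrightarrow> fires (alt s t n) x t = real (Suc n) - 1"
      using fires_alt[OF assms(1), of "\<lambda>n. real n - 1" x n] x w by auto
    moreover have "even n \<longrightarrow> fires (alt t s n) x t = real (Suc n)"
         "odd n \<longrightarrow> fires (alt t s n) x t = - real n"
      using fires_alt[OF assms(1)[symmetric], of "\<lambda>n. real n" x n] x w by auto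
    ultimately have False using eq assms(3) by (cases "even n") auto
    then show ?thesis ..
  qed
qed

section \<open>The transducer on minimal coset representatives\<close>

text \<open>
In the Schreier graph of the cosets \<open>W\<^sub>X q\<close>, the letter \<open>s\<close> is a loop at \<open>q\<close> if it does not change
the coset; for a minimal representative this means \<open>q s = x q\<close>, and \<open>x\<close> is the label of the loop.
\<close>

definition loop :: "'a set \<Rightarrow> 'a list \<Rightarrow> 'a \<Rightarrow> bool" where
  "loop X q s \<longleftrightarrow> (\<exists>x\<in>X. q @ [s] \<approx> x # q)"

definition label :: "'a set \<Rightarrow> 'a list \<Rightarrow> 'a \<Rightarrow> 'a" where
  "label X q s = (SOME x. x \<in> X \<and> q @ [s] \<approx> x # q)"

text \<open>
Signs do not influence the path, since generators of \<open>W\<close> are involutions; they are only copied to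
the output.
\<close>

primrec transduce :: "'a set \<Rightarrow> 'a word \<Rightarrow> 'a list \<Rightarrow> 'a word" where
  "transduce X [] q = []"
| "transduce X (l # w) q = (if loop X q (fst l) then (label X q (fst l), snd l) # transduce X w q
     else transduce X w (q @ [fst l]))"

primrec end_state :: "'a set \<Rightarrow> 'a word \<Rightarrow> 'a list \<Rightarrow> 'a list" where
  "end_state X [] q = q"
| "end_state X (l # w) q = (if loop X q (fst l) then end_state X w q else end_state X w (q @ [fst l]))"

lemma Cons_cancel_right: "x # q \<approx> y # q \<longleftrightarrow> x = y"
  using cox_cancel_right[of "[x]" q "[y]"] cox_single_inj by auto

lemma label_eqI:
  assumes "x \<in> X" "q @ [s] \<approx> x # q"
  shows "label X q s = x" "loop X q s"
proof -
  show "loop X q s" using assms by (auto simp: loop_def)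
  have "label X q s \<in> X \<and> q @ [s] \<approx> label X q s # q"
    unfolding label_def by (rule someI[of _ x]) (use assms in simp)
  then show "label X q s = x"
    using assms Cons_cancel_right cox_sym cox_trans by blast
qed

lemma loopD: "loop X q s \<Longrightarrow> label X q s \<in> X" "loop X q s \<Longrightarrow> q @ [s] \<approx> label X q s # q"
  by (auto simp: loop_def label_eqI)

lemma loop_eq_cong:
  assumes "q \<approx> q'"
  shows "q @ [s] \<approx> x # q \<longleftrightarrow> q' @ [s] \<approx> x # q'"
  using assms by (intro cox_cong cox_Cons cox_append_right)

lemma loop_cong: "q \<approx> q' \<Longrightarrow> loop X q s = loop X q' s" "q \<approx> q' \<Longrightarrow> label X q s = label X q' s"
  by (simp_all add: loop_def label_def loop_eq_cong)

lemma transduce_append: "transduce X (u @ v) q = transduce X u q @ transduce X v (end_state X u q)"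
  by (induction u arbitrary: q) auto

lemma end_state_append: "end_state X (u @ v) q = end_state X v (end_state X u q)"
  by (induction u arbitrary: q) auto

lemma transduce_cong: "q \<approx> q' \<Longrightarrow> transduce X w q = transduce X w q' \<and> end_state X w q \<approx> end_state X w q'"
proof (induction w arbitrary: q q')
  case (Cons l w)
  then show ?case
    using loop_cong[OF Cons.prems] cox_append_right[OF Cons.prems] by auto
qed auto

lemma transduce_words [simp]: "transduce X w q \<in> words X"
  by (induction w arbitrary: q) (auto simp: loopD)

lemma length_transduce: "length (transduce X w q) \<le> length w"
  by (induction w arbitrary: q) (auto intro: le_SucI)

text \<open>
The transducer computes the decomposition of \<open>q w\<close> as an element of \<open>W\<^sub>X\<close> times its state.
\<close>

lemma transduce_trace: "q @ map fst w \<approx> map fst (transduce X w q) @ end_state X w q"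
proof (induction w arbitrary: q)
  case (Cons l w)
  show ?case
  proof (cases "loop X q (fst l)")
    case True
    have "(q @ [fst l]) @ map fst w \<approx> (label X q (fst l) # q) @ map fst w"
      using loopD(2)[OF True] by (rule cox_append_right)
    also have "(label X q (fst l) # q) @ map fst w \<approx>
        label X q (fst l) # map fst (transduce X w q) @ end_state X w q"
      using cox_Cons[OF Cons[of q]] by simp
    finally show ?thesis using True by simp
  next
    case False
    then show ?thesis using Cons[of "q @ [fst l]"] by simp
  qed
qed auto

definition min_rep :: "'a set \<Rightarrow> 'a list \<Rightarrow> bool" where
  "min_rep X q \<longleftrightarrow> (\<forall>x\<in>X. ell q < ell (x # q))"

text \<open>
Deodhar's lemma. If \<open>q s\<close> is not minimal, some \<open>x \<in> X\<close> shortens it although \<open>x\<close> lengthens \<open>q\<close>; the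
letter deleted by the exchange condition must then be \<open>s\<close> itself, which says \<open>x q s = q\<close>.
\<close>

lemma min_rep_snoc:
  assumes q: "min_rep X q" and nl: "\<not> loop X q s"
  shows "min_rep X (q @ [s])"
  unfolding min_rep_def
proof (rule ballI, rule ccontr)
  fix x assume x: "x \<in> X" and "\<not> ell (q @ [s]) < ell (x # q @ [s])"
  then have less: "ell (x # q @ [s]) < ell (q @ [s])"
    using ell_Cons_neq[of x "q @ [s]"] by simp
  have xq: "ell q < ell (x # q)" using q x by (simp add: min_rep_def)
  have "ell (x # q) \<le> Suc (ell (x # q @ [s]))"
    using ell_snoc_le[of "x # q @ [s]" s] ell_cong[OF cox_square[of "x # q" s "[]"]] by simp
  then have qs: "ell (q @ [s]) = Suc (ell q)"
    using less xq ell_snoc_le[of q s] by linarith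
  obtain v where v: "v \<approx> q" "length v = ell q" by (rule ell_obtain)
  have vs: "v @ [s] \<approx> q @ [s]" using v(1) by (rule cox_append_right)
  have "ell (v @ [s]) = length (v @ [s])"
    using ell_cong[OF vs] qs v(2) by simp
  moreover have "ell (x # v @ [s]) \<le> length (v @ [s])"
    using ell_cong[OF cox_Cons[OF vs], of x] less qs v(2) by simp
  ultimately obtain w1 a w2 where w: "v @ [s] = w1 @ a # w2" "x # v @ [s] \<approx> w1 @ w2"
    using exchange by blast
  show False
  proof (cases w2 rule: rev_cases)
    case Nil
    then have "x # v @ [s] \<approx> v" using w by simp
    then have "v @ [s] \<approx> x # v" by (simp add: cox_move_Cons)
    then have "q @ [s] \<approx> x # q" using loop_eq_cong[OF v(1)] by simp
    then show False using nl x by (auto simp: loop_def)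
  next
    case (snoc w2' b)
    then have "v = w1 @ a # w2'" "b = s" using w(1) by auto
    then have "x # v \<approx> w1 @ w2'"
      using w(2) snoc cox_cancel_right[of "x # v" "[s]" "w1 @ w2'"] by simp
    then have "x # q \<approx> w1 @ w2'" using v(1) cox_Cons cox_sym cox_trans by blast
    then have "ell (x # q) \<le> length (w1 @ w2')" using ell_le cox_sym by blast
    then show False using xq v(2) \<open>v = w1 @ a # w2'\<close> by simp
  qed
qed

lemma min_rep_end_state: "min_rep X q \<Longrightarrow> min_rep X (end_state X w q)"
  by (induction w arbitrary: q) (auto simp: min_rep_snoc)

lemma min_rep_Nil: "min_rep X []"
proof -
  have "ell [] = 0" using ell_le[of "[]" "[]"] by simp
  moreover have "ell [x] \<noteq> ell []" for x using ell_Cons_neq[of x "[]"] by simp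
  ultimately show ?thesis by (metis gr0I min_rep_def)
qed

abbreviation positive :: "'a list \<Rightarrow> 'a word" where
  "positive w \<equiv> map (\<lambda>x. (x, True)) w"

lemma map_fst_positive [simp]: "map fst (positive w) = w"
  by (induction w) auto

section \<open>Reading a braid relation\<close>

text \<open>
These are the elements of \<open>X\<close> that can occur as labels while letters \<open>s\<close> and \<open>t\<close> are read from
\<open>q\<close>, namely \<open>X \<inter> q \<langle>s, t\<rangle> q\<^sup>-\<^sup>1\<close>.
\<close>

definition orbit_labels :: "'a set \<Rightarrow> 'a \<Rightarrow> 'a \<Rightarrow> 'a list \<Rightarrow> 'a set" where
  "orbit_labels X s t q = {x \<in> X. \<exists>\<tau>. set \<tau> \<subseteq> {s, t} \<and> x # q \<approx> q @ \<tau>}"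

lemma orbit_labels_snoc:
  assumes "c \<in> {s, t}"
  shows "orbit_labels X s t (q @ [c]) \<subseteq> orbit_labels X s t q"
proof
  fix x assume "x \<in> orbit_labels X s t (q @ [c])"
  then obtain \<tau> where x: "x \<in> X" "set \<tau> \<subseteq> {s, t}" "x # (q @ [c]) \<approx> (q @ [c]) @ \<tau>"
    by (auto simp: orbit_labels_def)
  then have "x # q \<approx> q @ ([c] @ \<tau> @ [c])"
    using cox_move_snoc[of "x # q" c "(q @ [c]) @ \<tau>"] by simp
  moreover have "set ([c] @ \<tau> @ [c]) \<subseteq> {s, t}" using x(2) assms by auto
  ultimately show "x \<in> orbit_labels X s t q" using x(1) unfolding orbit_labels_def by blast
qed

lemma label_in_orbit_labels:
  assumes "loop X q c" "c \<in> {s, t}"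
  shows "label X q c \<in> orbit_labels X s t q"
proof -
  have "set [c] \<subseteq> {s, t}" "label X q c # q \<approx> q @ [c]"
    using assms loopD cox_sym by auto
  then show ?thesis using loopD(1)[OF assms(1)] unfolding orbit_labels_def by blast
qed

text \<open>
If only \<open>x\<close> can be emitted, it is emitted exactly when the path crosses the wall of \<open>q\<^sup>-\<^sup>1 x q\<close>.
\<close>

lemma transduce_single_label:
  assumes "orbit_labels X s t q \<subseteq> {x}" "set w \<subseteq> {s, t}"
  shows "transduce X (positive w) q =
    replicate (if x \<in> X then refl_count w (rev q @ [x] @ q) else 0) (x, True)"
  using assms
proof (induction w arbitrary: q)
  case (Cons c w)
  have iff: "loop X q c \<longleftrightarrow> x \<in> X \<and> [c] \<approx> rev q @ [x] @ q"
  proof -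
    have "[c] \<approx> rev q @ [x] @ q \<longleftrightarrow> q @ [c] \<approx> x # q"
      using cox_move_left[of q "[c]" "x # q"] by simp
    moreover have "loop X q c \<Longrightarrow> label X q c = x"
      using label_in_orbit_labels[of X q c s t] Cons.prems by auto
    ultimately show ?thesis using label_eqI[of x X q c] loopD[of X q c] by auto
  qed
  show ?case
  proof (cases "loop X q c")
    case True
    then have x: "x \<in> X" "[c] \<approx> rev q @ [x] @ q" using iff by auto
    then have "q @ [c] \<approx> x # q" using cox_move_left[of q "[c]" "x # q"] by simp
    then have "label X q c = x" using x label_eqI by blast
    moreover have "c # (rev q @ [x] @ q) @ [c] \<approx> rev q @ [x] @ q"
    proof -
      have "c # (rev q @ [x] @ q) @ [c] \<approx> c # [c] @ [c]"
        using cox_sym[OF x(2)] by (intro cox_Cons cox_append_right)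
      also have "c # [c] @ [c] \<approx> [c]" using cox_square_Cons[of c "[c]"] by simp
      also note x(2)
      finally show ?thesis .
    qed
    note refl_count_cong[OF this, of w]
    ultimately show ?thesis
      using True x Cons by simp
  next
    case False
    have "orbit_labels X s t (q @ [c]) \<subseteq> {x}"
      using orbit_labels_snoc[of c s t X q] Cons.prems by auto
    then have "transduce X (positive w) (q @ [c]) =
      replicate (if x \<in> X then refl_count w (rev (q @ [c]) @ [x] @ (q @ [c])) else 0) (x, True)"
      using Cons.prems by (intro Cons.IH) auto
    then show ?thesis using False iff by auto
  qed
qed auto

lemma coset_min_obtain:
  obtains v d where "q \<approx> v @ d" "set d \<subseteq> {s, t}" "coset_min s t v"
    "\<And>d'. d' \<approx> d \<Longrightarrow> set d' \<subseteq> {s, t} \<Longrightarrow> length d \<le> length d'"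
proof -
  have "\<exists>v. (\<exists>d. q \<approx> v @ d \<and> set d \<subseteq> {s, t}) \<and>
      (\<forall>v'. (\<exists>d. q \<approx> v' @ d \<and> set d \<subseteq> {s, t}) \<longrightarrow> length v \<le> length v')"
    by (rule ex_has_least_nat[of _ q]) (auto intro: exI[of _ "[]"])
  then obtain v d0 where v: "q \<approx> v @ d0" "set d0 \<subseteq> {s, t}"
    and min: "\<And>v' d. q \<approx> v' @ d \<Longrightarrow> set d \<subseteq> {s, t} \<Longrightarrow> length v \<le> length v'" by blast
  have "\<exists>e. (e \<approx> d0 \<and> set e \<subseteq> {s, t}) \<and> (\<forall>e'. e' \<approx> d0 \<and> set e' \<subseteq> {s, t} \<longrightarrow> length e \<le> length e')"
    using v by (intro ex_has_least_nat[of _ d0]) auto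
  then obtain d where d: "d \<approx> d0" "set d \<subseteq> {s, t}"
    and dmin: "\<And>e'. e' \<approx> d0 \<Longrightarrow> set e' \<subseteq> {s, t} \<Longrightarrow> length d \<le> length e'" by blast
  have q: "q \<approx> v @ d" using v(1) cox_append_left[OF d(1), of v] cox_sym cox_trans by blast
  \<comment> \<open>minimality only depends on the coset, which \<open>v\<close> and \<open>q\<close> share\<close>
  have "coset_min s t v"
    unfolding coset_min_def
  proof (intro allI impI)
    fix v' d' assume *: "v \<approx> v' @ d'" "set d' \<subseteq> {s, t}"
    have "q \<approx> v' @ (d' @ d)"
      using q cox_append_right[OF *(1), of d] cox_trans by auto
    then show "length v \<le> length v'" by (rule min) (use * d in auto)
  qed
  then show ?thesis using that[of v d] q d dmin cox_trans by blast
qed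

text \<open>
Let \<open>q = v d\<close> with \<open>v\<close> shortest in \<open>q \<langle>s, t\<rangle>\<close>. Every label \<open>z\<close> satisfies \<open>z v = v s\<close> or \<open>z v = v t\<close>, so
two labels make both \<open>s\<close> and \<open>t\<close> loops at \<open>v\<close>. If \<open>d\<close> began with a letter \<open>a\<close>, the label of \<open>a\<close> at \<open>v\<close>
would shorten \<open>q\<close>, against its minimality; hence \<open>q = v\<close>.
\<close>

lemma orbit_labels_two:
  assumes q: "min_rep X q" and xy: "x \<in> orbit_labels X s t q" "y \<in> orbit_labels X s t q" "x \<noteq> y"
    and c: "c \<in> {s, t}"
  shows "\<exists>z\<in>X. q @ [c] \<approx> z # q"
proof -
  obtain v d where v: "q \<approx> v @ d" "set d \<subseteq> {s, t}" "coset_min s t v"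
    and d: "\<And>d'. d' \<approx> d \<Longrightarrow> set d' \<subseteq> {s, t} \<Longrightarrow> length d \<le> length d'"
    by (rule coset_min_obtain[of q s t]) blast
  have *: "v @ [s] \<approx> z # v \<or> v @ [t] \<approx> z # v" if z: "z \<in> orbit_labels X s t q" for z
  proof -
    obtain \<tau> where \<tau>: "set \<tau> \<subseteq> {s, t}" "z # q \<approx> q @ \<tau>"
      using z by (auto simp: orbit_labels_def)
    have "z # v @ d \<approx> (v @ d) @ \<tau>"
      using \<tau>(2) cox_cong[OF cox_Cons[OF v(1), of z] cox_append_right[OF v(1), of \<tau>]] by simp
    then have zv: "z # v \<approx> v @ (d @ \<tau> @ rev d)"
      using cox_move_right[of "z # v" d "(v @ d) @ \<tau>"] by simp
    have "d @ \<tau> @ rev d \<approx> [s] \<or> d @ \<tau> @ rev d \<approx> [t]"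
      using v(2) \<tau>(1) by (intro coset_min_reflection[OF v(3) _ zv]) auto
    then show ?thesis
      using zv cox_append_left cox_sym cox_trans by meson
  qed
  have uniq: "z = z'" if "v @ [c] \<approx> z # v" "v @ [c] \<approx> z' # v" for c z z'
    using that Cons_cancel_right cox_sym cox_trans by blast
  have loops: "\<exists>z\<in>X. v @ [c] \<approx> z # v" if "c \<in> {s, t}" for c
    using *[OF xy(1)] *[OF xy(2)] uniq that xy unfolding orbit_labels_def by blast
  have "d = []"
  proof (rule ccontr)
    assume "d \<noteq> []"
    then obtain a d' where a: "d = a # d'" by (cases d) auto
    then obtain z where z: "z \<in> X" "v @ [a] \<approx> z # v" using loops v(2) by auto
    have "z # q \<approx> (z # v) @ d" using cox_Cons[OF v(1), of z] by simp
    also have "\<dots> \<approx> (v @ [a]) @ d" using z(2) cox_sym cox_append_right by blast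
    also have "\<dots> \<approx> v @ d'" using a cox_append_left[OF cox_square_Cons, of v a d'] by simp
    finally have "ell (z # q) \<le> length (v @ d')" using ell_le cox_sym by blast
    moreover have "ell q = length v + length d"
      using ell_cong[OF v(1)] ell_coset_min_append[OF v(3,2)] d by auto
    ultimately show False using q z(1) a unfolding min_rep_def by fastforce
  qed
  then show ?thesis using loops[OF c] loop_eq_cong[of q v c] v(1) by auto
qed

lemma transduce_all_loops:
  assumes "\<And>c. c \<in> set w \<Longrightarrow> g c \<in> X \<and> q @ [c] \<approx> g c # q"
  shows "transduce X (positive w) q = positive (map g w) \<and> end_state X (positive w) q = q \<and> q @ w \<approx> map g w @ q"
  using assms
proof (induction w)
  case (Cons c w)
  have c: "g c \<in> X" "q @ [c] \<approx> g c # q" using Cons.prems by auto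
  have IH: "transduce X (positive w) q = positive (map g w) \<and> end_state X (positive w) q = q \<and> q @ w \<approx> map g w @ q"
    using Cons by auto
  have "q @ c # w \<approx> g c # q @ w"
    using cox_append_right[OF c(2), of w] by simp
  also have "\<dots> \<approx> g c # map g w @ q" using IH by (intro cox_Cons) auto
  finally show ?case using IH label_eqI[OF c] by simp
qed auto

text \<open>
With at most one label available, both sides emit the same power of it, because they cross the same
walls. With two labels, the state does not move, and the output is the image of the relation
under conjugation by \<open>q\<close>; it is a defining relation of \<open>A\<^sub>X\<close>, since conjugation preserves the order of a
product of two generators, which is the label.
\<close>

lemma transduce_braid:
  assumes q: "min_rep X q" and st: "s \<noteq> t" "m s t = enat k"
  shows "pres_eq X (artin_relations X m) (transduce X (positive (alt s t k)) q) (transduce X (positive (alt t s k)) q)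
    \<and> end_state X (positive (alt s t k)) q \<approx> end_state X (positive (alt t s k)) q"
proof (cases "\<exists>x y. x \<in> orbit_labels X s t q \<and> y \<in> orbit_labels X s t q \<and> x \<noteq> y")
  case True
  then have "\<exists>z\<in>X. q @ [c] \<approx> z # q" if "c \<in> {s, t}" for c
    using orbit_labels_two[OF q] that by blast
  then obtain g where g: "\<And>c. c \<in> {s, t} \<Longrightarrow> g c \<in> X \<and> q @ [c] \<approx> g c # q" by metis
  have all: "transduce X (positive w) q = positive (map g w) \<and> end_state X (positive w) q = q \<and> q @ w \<approx> map g w @ q"
    if "set w \<subseteq> {s, t}" for w
    using g that by (intro transduce_all_loops) auto
  have alt_iff: "alt s t n \<approx> alt t s n \<longleftrightarrow> alt (g s) (g t) n \<approx> alt (g t) (g s) n" for n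
  proof -
    have sub: "set (alt s t n) \<subseteq> {s, t}" "set (alt t s n) \<subseteq> {s, t}"
      using set_alt[of s t n] set_alt[of t s n] by auto
    have "alt s t n \<approx> alt t s n \<longleftrightarrow> q @ alt s t n \<approx> q @ alt t s n"
      by (simp add: cox_cancel_left)
    also have "\<dots> \<longleftrightarrow> map g (alt s t n) @ q \<approx> map g (alt t s n) @ q"
      using all[OF sub(1)] all[OF sub(2)] by (intro cox_cong) auto
    also have "\<dots> \<longleftrightarrow> alt (g s) (g t) n \<approx> alt (g t) (g s) n"
      by (simp add: cox_cancel_right map_alt)
    finally show ?thesis .
  qed
  have k: "k > 0" using m_ge_2[OF st(1)] st(2) by (auto simp: numeral_eq_enat)
  have "g s \<noteq> g t"
  proof
    assume "g s = g t"
    then have "alt s t 1 \<approx> alt t s 1" using alt_iff[of 1] by simp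
    then show False using cox_single_inj st(1) by simp
  qed
  have "alt s t k \<approx> alt t s k" using cox_braid[OF st, of "[]" "[]"] by simp
  \<comment> \<open>divisibility in both directions shows that the labels agree\<close>
  then obtain k' where k': "m (g s) (g t) = enat k'" "k' dvd k"
    using alt_iff[of k] alt_eq_dvd[OF \<open>g s \<noteq> g t\<close>] k by blast
  then have "alt (g s) (g t) k' \<approx> alt (g t) (g s) k'" 
    using cox_braid[OF \<open>g s \<noteq> g t\<close>, of k' "[]" "[]"] by simp
  moreover have "k' > 0" using k' k by (auto intro: Nat.gr0I)
  ultimately have "k dvd k'" using alt_iff alt_eq_dvd[OF st(1)] st(2) by fastforce
  then have kk: "k' = k" using k'(2) by (simp add: dvd_antisym)
  define l r where "l = positive (alt (g s) (g t) k)" and "r = positive (alt (g t) (g s) k)"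
  have "(l, r) \<in> artin_relations X m"
    unfolding artin_relations_def l_def r_def alternating_eq_alt map_alt
    using g k'(1) kk \<open>g s \<noteq> g t\<close> by blast
  moreover have "positive (alt a b n) \<in> words X" if "a \<in> X" "b \<in> X" for a b n
    using that set_alt[of a b n] by (auto simp: words_def)
  then have "l \<in> words X" "r \<in> words X" using g by (auto simp: l_def r_def)
  ultimately have "pres_eq X (artin_relations X m) l r"
    using pres_eq_rel[of l r "artin_relations X m" X "[]" "[]"] by simp
  moreover have "transduce X (positive (alt s t k)) q = l" "transduce X (positive (alt t s k)) q = r"
    "end_state X (positive (alt s t k)) q = q" "end_state X (positive (alt t s k)) q = q"
    using all[of "alt s t k"] all[of "alt t s k"] set_alt[of s t k] set_alt[of t s k]
    by (auto simp: l_def r_def map_alt)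
  ultimately show ?thesis by simp
next
  case False
  then obtain x where x: "orbit_labels X s t q \<subseteq> {x}" by blast
  have sub: "set (alt s t k) \<subseteq> {s, t}" "set (alt t s k) \<subseteq> {s, t}"
    using set_alt[of s t k] set_alt[of t s k] by auto
  have eq: "transduce X (positive (alt s t k)) q = transduce X (positive (alt t s k)) q"
    by (simp add: transduce_single_label[OF x sub(1)] transduce_single_label[OF x sub(2)] refl_count_braid[OF st])
  have "alt s t k \<approx> alt t s k" using cox_braid[OF st, of "[]" "[]"] by simp
  then have "q @ alt s t k \<approx> q @ alt t s k" by (rule cox_append_left)
  then have "map fst (transduce X (positive (alt t s k)) q) @ end_state X (positive (alt s t k)) q \<approx>
      map fst (transduce X (positive (alt t s k)) q) @ end_state X (positive (alt t s k)) q"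
    using cox_cong[OF transduce_trace[of q "positive (alt s t k)" X] transduce_trace[of q "positive (alt t s k)" X]]
    by (simp only: eq map_fst_positive)
  then have "end_state X (positive (alt s t k)) q \<approx> end_state X (positive (alt t s k)) q"
    by (simp only: cox_cancel_left)
  then show ?thesis using eq by (simp add: pres_eq_refl)
qed

lemma transduce_pres_eq:
  assumes "pres_eq S (artin_relations S m) u v" "min_rep X q"
  shows "pres_eq X (artin_relations X m) (transduce X u q) (transduce X v q) \<and> end_state X u q \<approx> end_state X v q"
  using assms
proof (induction arbitrary: q rule: pres_eq.induct)
  case (pres_eq_refl w)
  then show ?case by (simp add: pres_eq.pres_eq_refl)
next
  case (pres_eq_sym u v)
  then show ?case by (meson pres_eq.pres_eq_sym cox_sym)
next
  case (pres_eq_trans u v w)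
  then show ?case by (meson pres_eq.pres_eq_trans cox_trans)
next
  case (pres_eq_cancel u v x b)
  define p where "p = end_state X u q"
  have p: "min_rep X p" unfolding p_def using pres_eq_cancel.prems by (rule min_rep_end_state)
  have "pres_eq X (artin_relations X m) (transduce X [(x, b), (x, \<not> b)] p) [] \<and> end_state X [(x, b), (x, \<not> b)] p \<approx> p"
  proof (cases "loop X p x")
    case True
    then show ?thesis
      using pres_eq.pres_eq_cancel[of "[]" X "[]" "label X p x" "artin_relations X m" b] loopD(1) by simp
  next
    case False
    have pxx: "(p @ [x]) @ [x] \<approx> p" using cox_square[of p x "[]"] by simp
    have "\<not> loop X (p @ [x]) x"
    proof
      assume "loop X (p @ [x]) x"
      then obtain y where y: "y \<in> X" "(p @ [x]) @ [x] \<approx> y # p @ [x]" by (auto simp: loop_def)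
      then have "p \<approx> (y # p) @ [x]" using pxx cox_sym cox_trans by (metis append_Cons)
      then have "p @ [x] \<approx> y # p" using cox_move_snoc cox_sym by blast
      then show False using False y(1) by (auto simp: loop_def)
    qed
    then show ?thesis using False pxx by (simp add: pres_eq.pres_eq_refl)
  qed
  then have mid: "pres_eq X (artin_relations X m) (transduce X [(x, b), (x, \<not> b)] p) []"
    "end_state X [(x, b), (x, \<not> b)] p \<approx> p" by blast+
  have "transduce X (u @ [(x, b), (x, \<not> b)] @ v) q = transduce X u q @ transduce X [(x, b), (x, \<not> b)] p @ transduce X v p"
    unfolding transduce_append[of X u] transduce_append[of X "[(x, b), (x, \<not> b)]"] p_def[symmetric]
    using transduce_cong[OF mid(2), of X v] by simp
  moreover have "pres_eq X (artin_relations X m)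
      (transduce X u q @ transduce X [(x, b), (x, \<not> b)] p @ transduce X v p) (transduce X u q @ [] @ transduce X v p)"
    by (intro pres_eq_append mid(1) pres_eq.pres_eq_refl) auto
  moreover have "end_state X (u @ [(x, b), (x, \<not> b)] @ v) q \<approx> end_state X (u @ v) q"
    unfolding end_state_append[of X u] end_state_append[of X "[(x, b), (x, \<not> b)]"] p_def[symmetric]
    using transduce_cong[OF mid(2), of X v] by simp
  ultimately show ?case by (simp add: transduce_append p_def del: transduce.simps(2) end_state.simps(2))
next
  case (pres_eq_rel l r u v)
  define p where "p = end_state X u q"
  have p: "min_rep X p" unfolding p_def using pres_eq_rel.prems by (rule min_rep_end_state)
  obtain s t k where st: "l = positive (alt s t k)" "r = positive (alt t s k)" "s \<noteq> t" "m s t = enat k"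
    using pres_eq_rel(1) by (auto simp: artin_relations_def alternating_eq_alt map_alt)
  have mid: "pres_eq X (artin_relations X m) (transduce X l p) (transduce X r p)" "end_state X l p \<approx> end_state X r p"
    using transduce_braid[OF p st(3,4)] by (simp_all only: st(1,2))
  have "pres_eq X (artin_relations X m)
      (transduce X u q @ transduce X l p @ transduce X v (end_state X r p)) (transduce X u q @ transduce X r p @ transduce X v (end_state X r p))"
    by (intro pres_eq_append mid(1) pres_eq.pres_eq_refl) auto
  then show ?case
    using transduce_cong[OF mid(2), of X v] by (simp add: transduce_append end_state_append p_def)
qed

lemma transduce_id: "w \<in> words X \<Longrightarrow> transduce X w [] = w \<and> end_state X w [] = []"
proof (induction w)
  case (Cons l w)
  then have "fst l \<in> X" "[] @ [fst l] \<approx> fst l # []" by auto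
  from label_eqI[OF this] show ?case using Cons by simp
qed auto

end

section \<open>The retraction onto a parabolic subgroup\<close>

text \<open>
A map of generators that carries relations to relations induces a homomorphism.
\<close>

lemma pres_eq_map:
  assumes "pres_eq S R u v" and "h ` S \<subseteq> S'"
    and "\<And>l r. (l, r) \<in> R \<Longrightarrow> l \<in> words S \<Longrightarrow> r \<in> words S \<Longrightarrow>
      (map (apfst h) l, map (apfst h) r) \<in> R'"
  shows "pres_eq S' R' (map (apfst h) u) (map (apfst h) v)"
proof -
  have words: "map (apfst h) w \<in> words S'" if "w \<in> words S" for w
    using that assms(2) by (induction w) auto
  show ?thesis using assms(1)
  proof (induction rule: pres_eq.induct)
    case (pres_eq_cancel u v x b)
    then show ?case
      using pres_eq.pres_eq_cancel[of "map (apfst h) u" S' "map (apfst h) v" "h x" R' b]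
        words assms(2) by auto
  next
    case (pres_eq_rel l r u v)
    then show ?case
      using pres_eq.pres_eq_rel[OF assms(3)[OF pres_eq_rel(1-3)], of S' "map (apfst h) u"
        "map (apfst h) v"] words by auto
  qed (auto intro: pres_eq.intros words)
qed

abbreviation artin_eq :: "'a set \<Rightarrow> ('a \<Rightarrow> 'a \<Rightarrow> enat) \<Rightarrow> 'a word \<Rightarrow> 'a word \<Rightarrow> bool" where
  "artin_eq S m \<equiv> pres_eq S (artin_relations S m)"

lemma artin_eq_mono: 
  assumes "artin_eq X m u v" "X \<subseteq> S"
  shows "artin_eq S m u v"
proof -
  have "artin_eq S m (map (apfst id) u) (map (apfst id) v)"
    using assms(1) by (rule pres_eq_map) (use assms(2) in \<open>auto simp: artin_relations_def\<close>)
  then show ?thesis by simp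
qed

text \<open>
The retraction is not a homomorphism; it only commutes with left multiplication by words over \<open>X\<close>,
because the initial state is a loop for every letter of \<open>X\<close>.
\<close>

theorem artin_retraction:
  assumes "coxeter_matrix S m" "X \<subseteq> S"
  obtains \<pi> where "\<And>w. \<pi> w \<in> words X" "\<And>w. length (\<pi> w) \<le> length w"
    "\<And>u v. artin_eq S m u v \<Longrightarrow> artin_eq X m (\<pi> u) (\<pi> v)"
    "\<And>u v. u \<in> words X \<Longrightarrow> \<pi> (u @ v) = u @ \<pi> v" "\<pi> [] = []"
proof -
  define m' where "m' = (\<lambda>s t. if s \<in> S \<and> t \<in> S then m s t else \<infinity>)"
  interpret coxeter m'
  proof
    fix s t
    show "m' s t = m' t s"
      using assms(1) by (cases "s = t") (auto simp: m'_def coxeter_matrix_def)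
    show "2 \<le> m' s t" if "s \<noteq> t"
      using assms(1) that by (auto simp: m'_def coxeter_matrix_def)
  qed
  have eq: "artin_relations Y m = artin_relations Y m'" if "Y \<subseteq> S" for Y
    using that unfolding artin_relations_def m'_def by (intro Collect_cong) (metis subsetD)
  show ?thesis
  proof (rule that[of "\<lambda>w. transduce X w []"])
    fix u v assume "artin_eq S m u v"
    then show "artin_eq X m (transduce X u []) (transduce X v [])"
      using transduce_pres_eq[OF _ min_rep_Nil] eq[OF assms(2)] eq[of S] by auto
  qed (auto simp: length_transduce transduce_append transduce_id)
qed

lemma word_inverse_word_inverse [simp]: "word_inverse (word_inverse w) = w"
  by (induction w) (auto simp: word_inverse_def)

lemma pres_eq_word_inverse_right: "w \<in> words X \<Longrightarrow> pres_eq X R (w @ word_inverse w) []"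
  using pres_eq_word_inverse[of "word_inverse w" X R] by simp

lemma words_mono: "w \<in> words X \<Longrightarrow> X \<subseteq> Y \<Longrightarrow> w \<in> words Y"
  by (auto simp: words_def)

section \<open>Amalgamated products of presented groups\<close>

text \<open>
A chosen representative of the group element, which makes the normal forms of an amalgam unique.
\<close>

definition nform :: "'a set \<Rightarrow> ('a word \<times> 'a word) set \<Rightarrow> 'a word \<Rightarrow> 'a word" where
  "nform X R u = (SOME v. pres_eq X R u v)"

lemma nform_eq: "u \<in> words X \<Longrightarrow> pres_eq X R u (nform X R u)"
  unfolding nform_def by (rule someI) (rule pres_eq_refl)

lemma nform_words: "u \<in> words X \<Longrightarrow> nform X R u \<in> words X"
  using nform_eq pres_eq_words by metis

lemma nform_cong:
  assumes "pres_eq X R u v"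
  shows "nform X R u = nform X R v"
proof -
  have "pres_eq X R u = pres_eq X R v"
    using pres_eq_trans[OF assms] pres_eq_trans[OF pres_eq_sym[OF assms]] by (intro ext iffI)
  then show ?thesis by (simp add: nform_def)
qed

lemma nform_idem: "u \<in> words X \<Longrightarrow> nform X R (nform X R u) = nform X R u"
  using nform_cong[OF pres_eq_sym[OF nform_eq]] .

text \<open>
Two presented groups, indexed by \<open>bool\<close>, with a common subgroup generated by the shared generators
\<open>X\<close>. The maps \<open>ret i\<close> are equivariant retractions onto that subgroup. They ensure that it embeds, and
they provide distinguished representatives of its cosets: the elements with trivial retraction.
\<close>

locale amalgam =
  fixes gens :: "bool \<Rightarrow> 'a set" and rels :: "bool \<Rightarrow> ('a word \<times> 'a word) set"
    and X :: "'a set" and RX :: "('a word \<times> 'a word) set"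
    and ret :: "bool \<Rightarrow> 'a word \<Rightarrow> 'a word"
  assumes Int_gens: "gens True \<inter> gens False = X"
    and rels_words: "(l, r) \<in> rels i \<Longrightarrow> l \<in> words (gens i) \<and> r \<in> words (gens i)"
    and base_eq: "pres_eq X RX u v \<Longrightarrow> pres_eq (gens i) (rels i) u v"
    and ret_words: "ret i w \<in> words X"
    and ret_cong: "pres_eq (gens i) (rels i) u v \<Longrightarrow> pres_eq X RX (ret i u) (ret i v)"
    and ret_append: "u \<in> words X \<Longrightarrow> ret i (u @ v) = u @ ret i v"
    and ret_Nil: "ret i [] = []"
begin

abbreviation "eqG i \<equiv> pres_eq (gens i) (rels i)"
abbreviation "eqX \<equiv> pres_eq X RX"
abbreviation "nfX \<equiv> nform X RX"
abbreviation "nf i \<equiv> nform (gens i) (rels i)"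

lemma X_subset: "X \<subseteq> gens i"
  using Int_gens by (cases i) auto

lemma words_X: "w \<in> words X \<Longrightarrow> w \<in> words (gens i)"
  using words_mono X_subset by blast

lemma ret_words_gens: "ret i w \<in> words (gens i)"
  using ret_words words_X by blast

text \<open>
Representatives of the nontrivial right cosets of the common subgroup in group \<open>i\<close>.
\<close>

definition coset_rep :: "bool \<Rightarrow> 'a word \<Rightarrow> bool" where
  "coset_rep i r \<longleftrightarrow> r \<in> words (gens i) \<and> nf i r = r \<and> eqX (ret i r) [] \<and> \<not> eqG i r []"

definition starts_off :: "bool \<Rightarrow> (bool \<times> 'a word) list \<Rightarrow> bool" where
  "starts_off i L \<longleftrightarrow> (L \<noteq> [] \<longrightarrow> fst (hd L) \<noteq> i)"

fun reduced_seq :: "(bool \<times> 'a word) list \<Rightarrow> bool" where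
  "reduced_seq [] \<longleftrightarrow> True"
| "reduced_seq ((i, r) # L) \<longleftrightarrow> coset_rep i r \<and> starts_off i L \<and> reduced_seq L"

text \<open>
The pair of \<open>k\<close> and \<open>[(i\<^sub>1, r\<^sub>1), \<dots>, (i\<^sub>n, r\<^sub>n)]\<close> stands for the product \<open>k r\<^sub>1 \<dots> r\<^sub>n\<close>, where \<open>k\<close> lies in the
common subgroup and the indices alternate.
\<close>

definition valid :: "'a word \<times> (bool \<times> 'a word) list \<Rightarrow> bool" where
  "valid z \<longleftrightarrow> fst z \<in> words X \<and> nfX (fst z) = fst z \<and> reduced_seq (snd z)"

text \<open>
For fixed \<open>i\<close>, the operations \<open>pop i\<close> and \<open>push i\<close> identify normal forms with pairs of an element of
group \<open>i\<close> and a normal form tail that does not begin with index \<open>i\<close>. On such pairs group \<open>i\<close> acts by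
left multiplication on the first component.
\<close>

definition pop :: "bool \<Rightarrow> 'a word \<times> (bool \<times> 'a word) list \<Rightarrow> 'a word \<times> (bool \<times> 'a word) list" where
  "pop i z = (if starts_off i (snd z) then z
     else (fst z @ snd (hd (snd z)), tl (snd z)))"

definition push :: "bool \<Rightarrow> 'a word \<times> (bool \<times> 'a word) list \<Rightarrow> 'a word \<times> (bool \<times> 'a word) list" where
  "push i z = (nfX (ret i (fst z)), if eqG i (fst z) (ret i (fst z)) then snd z
     else (i, nf i (word_inverse (ret i (fst z)) @ fst z)) # snd z)"

lemma starts_off_cases:
  obtains "starts_off i L" | r L' where "L = (i, r) # L'"
proof (cases "starts_off i L")
  case False
  then have "L = (i, snd (hd L)) # tl L" by (cases L) (auto simp: starts_off_def)
  then show ?thesis by (rule that(2))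
qed (rule that(1))

lemma starts_off_Nil [simp]: "starts_off i []"
  by (simp add: starts_off_def)

lemma starts_off_Cons [simp]: "starts_off i ((j, r) # L) \<longleftrightarrow> j \<noteq> i"
  by (simp add: starts_off_def)

lemma pop_valid:
  assumes "valid z"
  shows "fst (pop i z) \<in> words (gens i)" "reduced_seq (snd (pop i z))" "starts_off i (snd (pop i z))"
proof -
  obtain k L where z: "z = (k, L)" by (cases z)
  have "fst (pop i z) \<in> words (gens i) \<and> reduced_seq (snd (pop i z)) \<and> starts_off i (snd (pop i z))"
    by (cases rule: starts_off_cases[of i L]) (use assms words_X in \<open>auto simp: z pop_def valid_def coset_rep_def\<close>)
  then show "fst (pop i z) \<in> words (gens i)" "reduced_seq (snd (pop i z))" "starts_off i (snd (pop i z))"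
    by blast+
qed

lemma push_cong: "eqG i g h \<Longrightarrow> push i (g, L) = push i (h, L)"
proof -
  assume gh: "eqG i g h"
  have r: "eqX (ret i g) (ret i h)" using gh by (rule ret_cong)
  have "eqG i (ret i g) (ret i h)" using r by (rule base_eq)
  then have iff: "eqG i g (ret i g) \<longleftrightarrow> eqG i h (ret i h)"
    using gh by (meson pres_eq_sym pres_eq_trans)
  have "eqG i (word_inverse (ret i g) @ g) (word_inverse (ret i h) @ h)"
  proof (rule pres_eq_append[OF _ gh])
    let ?a = "ret i g" and ?b = "ret i h"
    note w = ret_words_gens[of i g] ret_words_gens[of i h]
    have "eqG i (word_inverse ?a @ ?b @ word_inverse ?b) (word_inverse ?a @ [])"
      using w by (intro pres_eq_append_left pres_eq_word_inverse_right) auto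
    moreover have "eqG i ((word_inverse ?a @ ?a) @ word_inverse ?b) ([] @ word_inverse ?b)"
      using w by (intro pres_eq_append_right pres_eq_word_inverse) auto
    moreover have "eqG i (word_inverse ?a @ ?a @ word_inverse ?b) (word_inverse ?a @ ?b @ word_inverse ?b)"
      using w \<open>eqG i ?a ?b\<close> by (intro pres_eq_append_left pres_eq_append_right) auto
    ultimately show "eqG i (word_inverse ?a) (word_inverse ?b)"
      by simp (meson pres_eq_sym pres_eq_trans)
  qed
  then show ?thesis
    by (simp add: push_def iff nform_cong[OF r] nform_cong)
qed

lemma ret_decomp:
  assumes "g \<in> words (gens i)"
  shows "eqG i (ret i g @ word_inverse (ret i g) @ g) g"
  using pres_eq_append_right[OF pres_eq_word_inverse_right[OF ret_words_gens[of i g]] assms] by simp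

lemma coset_rep_push:
  assumes g: "g \<in> words (gens i)" and ng: "\<not> eqG i g (ret i g)"
  shows "coset_rep i (nf i (word_inverse (ret i g) @ g))"
proof -
  let ?h = "word_inverse (ret i g) @ g"
  have h: "?h \<in> words (gens i)" using g ret_words_gens by simp
  have "eqX (ret i (nf i ?h)) (ret i ?h)"
    using nform_eq[OF h] by (intro ret_cong) (rule pres_eq_sym)
  moreover have "ret i ?h = word_inverse (ret i g) @ ret i g"
    using ret_words by (intro ret_append) simp
  moreover have "eqX (word_inverse (ret i g) @ ret i g) []"
    using ret_words by (rule pres_eq_word_inverse)
  ultimately have 1: "eqX (ret i (nf i ?h)) []" using pres_eq_trans by metis
  have "\<not> eqG i (nf i ?h) []"
  proof
    assume "eqG i (nf i ?h) []"
    then have "eqG i ?h []" using nform_eq[OF h] pres_eq_trans by metis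
    then have "eqG i (ret i g @ ?h) (ret i g @ [])"
      using ret_words_gens by (intro pres_eq_append_left)
    then show False using ng ret_decomp[OF g] by simp (meson pres_eq_sym pres_eq_trans)
  qed
  then show ?thesis using 1 nform_words[OF h] nform_idem[OF h] by (simp add: coset_rep_def)
qed

lemma push_valid:
  assumes g: "g \<in> words (gens i)" and L: "reduced_seq L" "starts_off i L"
  shows "valid (push i (g, L))"
  using coset_rep_push[OF g] L nform_words[OF ret_words] nform_idem[OF ret_words]
  by (auto simp: valid_def push_def)

lemma pop_push:
  assumes g: "g \<in> words (gens i)" and L: "starts_off i L"
  shows "\<exists>h. pop i (push i (g, L)) = (h, L) \<and> eqG i h g"
proof (cases "eqG i g (ret i g)")
  case True
  have "eqG i (nfX (ret i g)) (ret i g)"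
    using nform_eq[OF ret_words] by (intro base_eq) (rule pres_eq_sym)
  then show ?thesis
    using True L by (auto simp: pop_def push_def intro: pres_eq_sym pres_eq_trans)
next
  case False
  let ?h = "word_inverse (ret i g) @ g"
  have h: "?h \<in> words (gens i)" using g ret_words_gens by simp
  have "eqG i (nfX (ret i g) @ nf i ?h) (ret i g @ ?h)"
    by (intro pres_eq_append base_eq pres_eq_sym[OF nform_eq] ret_words h)
  then have "eqG i (nfX (ret i g) @ nf i ?h) g" using ret_decomp[OF g] pres_eq_trans by blast
  then show ?thesis using False by (simp add: pop_def push_def)
qed

lemma push_base:
  assumes "k \<in> words X"
  shows "push i (k, L) = (nfX k, L)"
  using assms ret_append[of k i "[]"] words_X[OF assms, of i] by (simp add: push_def ret_Nil pres_eq_refl)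

lemma push_rep:
  assumes k: "k \<in> words X" and r: "coset_rep i r"
  shows "push i (k @ r, L) = (nfX k, (i, r) # L)"
proof -
  have r': "r \<in> words (gens i)" "nf i r = r" "eqX (ret i r) []" "\<not> eqG i r []"
    using r by (auto simp: coset_rep_def)
  have ret: "ret i (k @ r) = k @ ret i r" using k by (rule ret_append)
  have eq: "eqX (k @ ret i r) k"
    using pres_eq_append_left[OF r'(3) k] by simp
  have kw: "k \<in> words (gens i)" using k by (rule words_X)
  have Ek: "eqG i (k @ ret i r) k" using eq by (rule base_eq)
  have n: "\<not> eqG i (k @ r) (k @ ret i r)"
  proof
    assume "eqG i (k @ r) (k @ ret i r)"
    then have "eqG i (k @ r) k" using Ek pres_eq_trans by metis
    then have "eqG i (word_inverse k @ k @ r) (word_inverse k @ k)"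
      using kw by (intro pres_eq_append_left) auto
    moreover have "eqG i (word_inverse k @ k) []" using kw by (rule pres_eq_word_inverse)
    moreover have "eqG i (word_inverse k @ k @ r) r"
      using pres_eq_append_right[OF pres_eq_word_inverse[OF kw] r'(1)] by simp
    ultimately show False using r'(4) by (meson pres_eq_sym pres_eq_trans)
  qed
  have "eqG i (word_inverse (k @ ret i r) @ k @ r) r"
  proof -
    have a: "k @ ret i r \<in> words (gens i)" using kw ret_words_gens by simp
    have "eqG i (word_inverse (k @ ret i r) @ k @ r) (word_inverse (k @ ret i r) @ (k @ ret i r) @ r)"
      using a r'(1) pres_eq_append_right[OF pres_eq_sym[OF Ek] r'(1)]
      by (intro pres_eq_append_left) auto
    moreover have "eqG i ((word_inverse (k @ ret i r) @ (k @ ret i r)) @ r) ([] @ r)"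
      using a r'(1) by (intro pres_eq_append_right pres_eq_word_inverse)
    ultimately show ?thesis using pres_eq_trans by fastforce
  qed
  then have "nf i (word_inverse (k @ ret i r) @ k @ r) = r" using nform_cong r'(2) by metis
  then show ?thesis using n nform_cong[OF eq] by (simp add: push_def ret)
qed

lemma push_pop:
  assumes "valid z"
  shows "push i (pop i z) = z"
proof (cases z)
  case (Pair k L)
  show ?thesis
    by (cases rule: starts_off_cases[of i L])
      (use assms in \<open>auto simp: Pair pop_def valid_def push_base push_rep\<close>)
qed

definition act :: "bool \<Rightarrow> 'a word \<Rightarrow> 'a word \<times> (bool \<times> 'a word) list \<Rightarrow> 'a word \<times> (bool \<times> 'a word) list" where
  "act i p z = push i (p @ fst (pop i z), snd (pop i z))"

lemma act_valid: "valid z \<Longrightarrow> p \<in> words (gens i) \<Longrightarrow> valid (act i p z)"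
  unfolding act_def by (rule push_valid) (auto simp: pop_valid)

lemma act_append:
  assumes z: "valid z" and p: "p \<in> words (gens i)" "q \<in> words (gens i)"
  shows "act i p (act i q z) = act i (p @ q) z"
proof -
  obtain h where h: "pop i (act i q z) = (h, snd (pop i z))" "eqG i h (q @ fst (pop i z))"
    unfolding act_def
    using pop_push[of "q @ fst (pop i z)" i "snd (pop i z)"] pop_valid[OF z, of i] p(2) by auto
  show ?thesis
    unfolding act_def[of i p] h(1) fst_conv snd_conv
    using push_cong[OF pres_eq_append_left[OF h(2) p(1)]] by (simp add: act_def)
qed

lemma act_cong: "valid z \<Longrightarrow> eqG i p q \<Longrightarrow> act i p z = act i q z"
  unfolding act_def by (intro push_cong pres_eq_append_right pop_valid)

lemma act_Nil: "valid z \<Longrightarrow> act i [] z = z"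
  by (simp add: act_def push_pop)

text \<open>
On the common subgroup the two actions agree, so they combine to an action of the pushout.
\<close>

lemma act_base:
  assumes z: "valid z" and c: "c \<in> words X"
  shows "act i c z = (nfX (c @ fst z), snd z)"
proof (cases z)
  case (Pair k L)
  show ?thesis
    by (cases rule: starts_off_cases[of i L])
      (use assms push_rep[of "c @ k" i] in \<open>auto simp: Pair pop_def valid_def act_def push_base\<close>)
qed

text \<open>
Shared generators are made to act through the index \<open>True\<close>; by \<open>act_base\<close> this choice is immaterial.
\<close>

definition word_act :: "'a word \<Rightarrow> 'a word \<times> (bool \<times> 'a word) list \<Rightarrow> 'a word \<times> (bool \<times> 'a word) list" where
  "word_act = foldr (\<lambda>l. act (fst l \<in> gens True) [l])"

lemma word_act_simps [simp]: "word_act [] z = z"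
  "word_act (l # w) z = act (fst l \<in> gens True) [l] (word_act w z)"
  "word_act (u @ v) z = word_act u (word_act v z)"
  by (simp_all add: word_act_def)

abbreviation "all_gens \<equiv> gens True \<union> gens False"
abbreviation "all_rels \<equiv> rels True \<union> rels False"

lemma in_gens: "x \<in> all_gens \<Longrightarrow> x \<in> gens (x \<in> gens True)"
  by (cases "x \<in> gens True") auto

lemma word_act_valid: "valid z \<Longrightarrow> w \<in> words all_gens \<Longrightarrow> valid (word_act w z)"
proof (induction w)
  case (Cons l w)
  have "[l] \<in> words (gens (fst l \<in> gens True))"
    using in_gens[of "fst l"] Cons.prems by (simp del: Un_iff)
  then show ?case using act_valid[OF Cons.IH] Cons.prems by simp
qed simp

lemma word_act_eq_act:
  assumes z: "valid z" and "w \<in> words (gens i)"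
  shows "word_act w z = act i w z"
  using assms(2)
proof (induction w)
  case Nil
  then show ?case using z by (simp add: act_Nil)
next
  case (Cons l w)
  then have l: "fst l \<in> gens i" and w: "w \<in> words (gens i)" by auto
  have v: "valid (act i w z)" using act_valid[OF z w] .
  have "act (fst l \<in> gens True) [l] (act i w z) = act i [l] (act i w z)"
  proof (cases "fst l \<in> X")
    case True
    then show ?thesis using act_base[OF v, of "[l]"] by simp
  next
    case False
    then have "(fst l \<in> gens True) = i" using l Int_gens by (cases i) auto
    then show ?thesis by simp
  qed
  also have "\<dots> = act i (l # w) z" using act_append[OF z, of "[l]" i w] l w by simp
  finally show ?case using Cons.IH w by simp
qed

lemma word_act_cong:
  assumes "pres_eq all_gens all_rels u v" "valid z"
  shows "word_act u z = word_act v z"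
  using assms
proof (induction arbitrary: z rule: pres_eq.induct)
  case (pres_eq_cancel u v x b)
  let ?z = "word_act v z"
  have v: "valid ?z" using pres_eq_cancel by (intro word_act_valid)
  obtain i where x: "x \<in> gens i" using pres_eq_cancel(3) by auto
  have "word_act [(x, b), (x, \<not> b)] ?z = act i [(x, b), (x, \<not> b)] ?z"
    using x by (intro word_act_eq_act v) auto
  also have "\<dots> = act i [] ?z"
    using pres_eq.pres_eq_cancel[of "[]" "gens i" "[]" x "rels i" b] x by (intro act_cong v) auto
  finally show ?case by (simp only: word_act_simps(3) act_Nil[OF v])
next
  case (pres_eq_rel l r u v)
  let ?z = "word_act v z"
  have v: "valid ?z" using pres_eq_rel by (intro word_act_valid)
  obtain i where i: "(l, r) \<in> rels i" using pres_eq_rel(1) by auto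
  note w = rels_words[OF i]
  have "eqG i l r"
    using pres_eq.pres_eq_rel[of l r "rels i" "gens i" "[]" "[]"] i w by simp
  then have "word_act l ?z = word_act r ?z"
    using word_act_eq_act[OF v, of l i] word_act_eq_act[OF v, of r i] act_cong[OF v] w by simp
  then show ?case by simp
qed auto

definition in_base :: "bool \<Rightarrow> 'a word \<Rightarrow> bool" where
  "in_base i p \<longleftrightarrow> (\<exists>c\<in>words X. eqG i p c)"

fun reduced_product :: "(bool \<times> 'a word) list \<Rightarrow> bool" where
  "reduced_product [] \<longleftrightarrow> True"
| "reduced_product ((i, p) # ps) \<longleftrightarrow> p \<in> words (gens i) \<and> \<not> in_base i p \<and> starts_off i ps \<and> reduced_product ps"

text \<open>
A factor outside of the common subgroup that meets a tail beginning with the other index is stored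
as a new entry, so the length of the normal form counts the factors.
\<close>

lemma word_act_reduced_product:
  assumes "reduced_product ps"
  defines "z \<equiv> word_act (concat (map snd ps)) (nfX [], [])"
  shows "valid z \<and> map fst (snd z) = map fst ps"
  using assms(1) unfolding z_def
proof (induction ps)
  case Nil
  then show ?case using nform_words[of "[]" X] nform_idem[of "[]" X] by (simp add: valid_def)
next
  case (Cons ip ps)
  obtain i p where ip: "ip = (i, p)" by (cases ip)
  let ?z = "word_act (concat (map snd ps)) (nfX [], [])"
  have p: "p \<in> words (gens i)" "\<not> in_base i p" "starts_off i ps"
    and IH: "valid ?z" "map fst (snd ?z) = map fst ps" using Cons ip by auto
  have off: "starts_off i (snd ?z)"
    using p(3) IH(2) unfolding starts_off_def by (metis list.map_disc_iff list.map_sel(1))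
  have k: "fst ?z \<in> words X" using IH(1) by (simp add: valid_def)
  let ?g = "p @ fst ?z"
  have "\<not> eqG i ?g (ret i ?g)"
  proof
    assume "eqG i ?g (ret i ?g)"
    then have "eqG i (?g @ word_inverse (fst ?z)) (ret i ?g @ word_inverse (fst ?z))"
      using words_X[OF k] by (intro pres_eq_append_right) auto
    moreover have "eqG i (p @ (fst ?z @ word_inverse (fst ?z))) (p @ [])"
      using p(1) words_X[OF k] by (intro pres_eq_append_left pres_eq_word_inverse_right)
    ultimately have "eqG i p (ret i ?g @ word_inverse (fst ?z))"
      by simp (meson pres_eq_sym pres_eq_trans)
    then show False using p(2) ret_words k unfolding in_base_def by auto
  qed
  then have "map fst (snd (act i p ?z)) = i # map fst ps"
    using off IH(2) by (simp add: act_def pop_def push_def)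
  then show ?case
    using word_act_eq_act[OF IH(1) p(1)] act_valid[OF IH(1) p(1)] ip by simp
qed

theorem reduced_product_nontrivial:
  assumes "reduced_product ps" "ps \<noteq> []"
  shows "\<not> pres_eq all_gens all_rels (concat (map snd ps)) []"
proof
  assume "pres_eq all_gens all_rels (concat (map snd ps)) []"
  moreover have "valid (nfX [], [])" using word_act_reduced_product[of "[]"] by simp
  ultimately show False
    using word_act_cong[of "concat (map snd ps)" "[]" "(nfX [], [])"]
      word_act_reduced_product[OF assms(1)] assms(2) by auto
qed

fun syllables :: "(bool \<times> 'a word) list \<Rightarrow> bool" where
  "syllables [] \<longleftrightarrow> True"
| "syllables ((i, p) # ps) \<longleftrightarrow> p \<in> words (gens i) \<and> p \<notin> words X \<and> starts_off i ps \<and> syllables ps"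

lemma syllables_exist:
  assumes "w \<in> words all_gens"
  shows "w \<in> words X \<or> (\<exists>ps. ps \<noteq> [] \<and> syllables ps \<and> concat (map snd ps) = w)"
  using assms
proof (induction w)
  case (Cons l w)
  obtain i where i: "fst l \<in> gens i" using Cons.prems by auto
  from Cons consider "w \<in> words X"
    | j p ps where "syllables ((j, p) # ps)" "concat (map snd ((j, p) # ps)) = w"
    by (metis list.exhaust prod.exhaust words_Cons)
  then show ?case
  proof cases
    case 1
    show ?thesis
    proof (cases "fst l \<in> X")
      case True
      then show ?thesis using 1 by simp
    next
      case False
      then show ?thesis using 1 i words_X[OF 1, of i]
        by (intro disjI2 exI[of _ "[(i, l # w)]"]) auto
    qed
  next
    case 2
    show ?thesis
    proof (cases "fst l \<in> gens j")
      case True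
      then show ?thesis using 2
        by (intro disjI2 exI[of _ "(j, l # p) # ps"]) auto
    next
      case False
      then have "i \<noteq> j" "fst l \<notin> X" using i X_subset[of j] by (cases i; cases j; auto)+
      then show ?thesis using 2 i
        by (intro disjI2 exI[of _ "(i, [l]) # (j, p) # ps"]) auto
    qed
  qed
qed simp

lemma syllables_cases:
  assumes "syllables ps"
  shows "reduced_product ps \<or>
    (\<exists>i u p v. concat (map snd ps) = u @ p @ v \<and> p \<in> words (gens i) \<and> p \<notin> words X \<and> in_base i p)"
  using assms
proof (induction ps)
  case (Cons ip ps)
  obtain i p where ip: "ip = (i, p)" by (cases ip)
  show ?case
  proof (cases "in_base i p")
    case True
    then show ?thesis using Cons.prems ip
      by (intro disjI2 exI[of _ i] exI[of _ "[]"] exI[of _ p] exI[of _ "concat (map snd ps)"]) auto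
  next
    case False
    then show ?thesis using Cons ip by (auto, metis append.assoc)
  qed
qed simp

text \<open>
This is the form in which the normal form theorem serves the algorithm: a trivial word that
involves both sides has a factor that can be moved into the common subgroup.
\<close>

theorem trivial_word_cases:
  assumes "pres_eq all_gens all_rels w []"
  shows "(\<exists>i. w \<in> words (gens i)) \<or>
    (\<exists>i u p v. w = u @ p @ v \<and> p \<in> words (gens i) \<and> p \<notin> words X \<and> in_base i p)"
proof -
  have "w \<in> words all_gens" using assms pres_eq_words by metis
  then consider "w \<in> words X" | ps where "ps \<noteq> []" "syllables ps" "concat (map snd ps) = w"
    using syllables_exist by blast
  then show ?thesis
  proof cases
    case 1
    then show ?thesis using words_X by blast
  next
    case 2
    then show ?thesis using syllables_cases[of ps] reduced_product_nontrivial[of ps] assms by metis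
  qed
qed

end

section \<open>Computable functions of natural numbers\<close>

text \<open>
The values of a recursive function on lists of the wrong length carry no meaning; they are
disregarded here, which makes the closure properties usable with arbitrary terms. A function of
several arguments is written with \<open>xs ! 0\<close>, \<open>xs ! 1\<close>, \<dots> for its arguments.
\<close>

definition computable :: "nat \<Rightarrow> (nat list \<Rightarrow> nat) \<Rightarrow> bool" where
  "computable n f \<longleftrightarrow> (\<exists>g. recursive n g \<and> (\<forall>xs. length xs = n \<longrightarrow> g xs = f xs))"

definition decidable :: "nat \<Rightarrow> (nat list \<Rightarrow> bool) \<Rightarrow> bool" where
  "decidable n P \<longleftrightarrow> computable n (\<lambda>xs. of_bool (P xs))"

lemma computable_cong:
  "(\<And>xs. length xs = n \<Longrightarrow> f xs = g xs) \<Longrightarrow> computable n f \<longleftrightarrow> computable n g"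
  by (simp add: computable_def cong: conj_cong)

lemma computable_congD:
  "computable n f \<Longrightarrow> (\<And>xs. length xs = n \<Longrightarrow> f xs = g xs) \<Longrightarrow> computable n g"
  using computable_cong by blast

lemma recursive_imp_computable: "recursive n f \<Longrightarrow> computable n f"
  by (auto simp: computable_def)

lemma computable_compose:
  assumes "computable (length gs) f" "\<forall>g\<in>set gs. computable n g"
  shows "computable n (\<lambda>xs. f (map (\<lambda>g. g xs) gs))"
proof -
  obtain f' where f': "recursive (length gs) f'" "\<And>xs. length xs = length gs \<Longrightarrow> f' xs = f xs"
    using assms(1) by (auto simp: computable_def)
  have "\<forall>g\<in>set gs. \<exists>g'. recursive n g' \<and> (\<forall>xs. length xs = n \<longrightarrow> g' xs = g xs)"
    using assms(2) by (simp add: computable_def)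
  then obtain G where G: "\<And>g. g \<in> set gs \<Longrightarrow> recursive n (G g)"
    "\<And>g xs. g \<in> set gs \<Longrightarrow> length xs = n \<Longrightarrow> G g xs = g xs" by metis
  have "recursive n (\<lambda>xs. f' (map (\<lambda>g. g xs) (map G gs)))"
    using f'(1) G(1) by (intro recursive_comp) auto
  moreover have "f' (map (\<lambda>g. g xs) (map G gs)) = f (map (\<lambda>g. g xs) gs)" if "length xs = n" for xs
    using f'(2)[of "map (\<lambda>g. g xs) gs"] G(2)[OF _ that] by (simp add: comp_def cong: map_cong)
  ultimately show ?thesis by (auto simp: computable_def)
qed

lemma computable_comp1:
  "computable 1 (\<lambda>xs. f (xs ! 0)) \<Longrightarrow> computable n g \<Longrightarrow> computable n (\<lambda>xs. f (g xs))"
  using computable_compose[of "[g]" "\<lambda>xs. f (xs ! 0)" n] by simp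

lemma computable_comp2:
  "computable 2 (\<lambda>xs. f (xs ! 0) (xs ! 1)) \<Longrightarrow> computable n g \<Longrightarrow> computable n h \<Longrightarrow>
    computable n (\<lambda>xs. f (g xs) (h xs))"
  using computable_compose[of "[g, h]" "\<lambda>xs. f (xs ! 0) (xs ! 1)" n]
  by (simp add: numeral_2_eq_2)

lemma decidable_comp1:
  "decidable 1 (\<lambda>xs. P (xs ! 0)) \<Longrightarrow> computable n g \<Longrightarrow> decidable n (\<lambda>xs. P (g xs))"
  unfolding decidable_def by (rule computable_comp1[of "\<lambda>x. of_bool (P x)"])

lemma decidable_comp2:
  "decidable 2 (\<lambda>xs. P (xs ! 0) (xs ! 1)) \<Longrightarrow> computable n g \<Longrightarrow> computable n h \<Longrightarrow>
    decidable n (\<lambda>xs. P (g xs) (h xs))"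
  unfolding decidable_def by (rule computable_comp2[of "\<lambda>x y. of_bool (P x y)"])

lemma computable_nth: "i < n \<Longrightarrow> computable n (\<lambda>xs. xs ! i)"
  by (rule recursive_imp_computable) (rule recursive_proj)

text \<open>
Weakening. A binder puts its variable in front of the argument list, so that below \<open>j\<close> binders an outer
variable appears as an entry of the \<open>j\<close>-fold tail.
\<close>

lemma computable_tl:
  assumes "computable n f"
  shows "computable (Suc n) (\<lambda>ys. f (tl ys))"
proof (rule computable_congD)
  show "computable (Suc n) (\<lambda>ys. f (map (\<lambda>g. g ys) (map (\<lambda>i ys. ys ! Suc i) [0..<n])))"
    using assms by (intro computable_compose) (auto intro: computable_nth)
  fix ys :: "nat list" assume "length ys = Suc n"
  then have "map (\<lambda>g. g ys) (map (\<lambda>i ys. ys ! Suc i) [0..<n]) = tl ys"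
    by (intro nth_equalityI) (auto simp: nth_tl)
  then show "f (map (\<lambda>g. g ys) (map (\<lambda>i ys. ys ! Suc i) [0..<n])) = f (tl ys)" by simp
qed

lemma computable_nth_tl1: "Suc i < n \<Longrightarrow> computable n (\<lambda>xs. tl xs ! i)"
  by (cases n) (auto intro: computable_tl computable_nth)

lemma computable_nth_tl2: "Suc (Suc i) < n \<Longrightarrow> computable n (\<lambda>xs. tl (tl xs) ! i)"
  by (cases n) (auto intro: computable_tl computable_nth_tl1)

lemma computable_nth_tl3: "Suc (Suc (Suc i)) < n \<Longrightarrow> computable n (\<lambda>xs. tl (tl (tl xs)) ! i)"
  by (cases n) (auto intro: computable_tl computable_nth_tl2)

lemma computable_nth_tl4: "Suc (Suc (Suc (Suc i))) < n \<Longrightarrow> computable n (\<lambda>xs. tl (tl (tl (tl xs))) ! i)"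
  by (cases n) (auto intro: computable_tl computable_nth_tl3)

lemmas computable_nth_tl = computable_nth_tl1 computable_nth_tl2 computable_nth_tl3 computable_nth_tl4

lemma computable_Suc: "computable n f \<Longrightarrow> computable n (\<lambda>xs. Suc (f xs))"
proof (rule computable_comp1[where f = Suc])
  have "computable 1 (\<lambda>xs. Suc (hd xs))"
    by (rule recursive_imp_computable) (rule recursive_succ)
  then show "computable 1 (\<lambda>xs. Suc (xs ! 0))"
    by (rule computable_congD) (auto simp: length_Suc_conv)
qed

lemma computable_const: "computable n (\<lambda>xs. c)"
proof (induction c)
  case 0
  show ?case by (rule recursive_imp_computable) (rule recursive_zero)
qed (rule computable_Suc)

text \<open>
The parameter list is passed on by the projections; only the recursion argument is replaced by \<open>h\<close>.
\<close>

lemma computable_rec: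
  assumes f: "computable n f" and g: "computable (Suc (Suc n)) (\<lambda>ys. g (ys ! 0) (ys ! 1) (tl (tl ys)))"
    and h: "computable n h"
  shows "computable n (\<lambda>xs. rec_nat (f xs) (\<lambda>k r. g k r xs) (h xs))"
proof -
  obtain f' where f': "recursive n f'" "\<And>xs. length xs = n \<Longrightarrow> f' xs = f xs"
    using f by (auto simp: computable_def)
  obtain g' where g': "recursive (Suc (Suc n)) g'"
    "\<And>ys. length ys = Suc (Suc n) \<Longrightarrow> g' ys = g (ys ! 0) (ys ! 1) (tl (tl ys))"
    using g by (auto simp: computable_def)
  define r where "r = (\<lambda>xs. rec_nat (f' (tl xs)) (\<lambda>k r. g' (k # r # tl xs)) (hd xs))"
  have "computable (Suc n) r"
    unfolding r_def by (intro recursive_imp_computable recursive_prec f'(1) g'(1))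
  then have "computable n (\<lambda>xs. r (map (\<lambda>g. g xs) (h # map (\<lambda>i xs. xs ! i) [0..<n])))"
    using h by (intro computable_compose) (auto intro: computable_nth)
  moreover have "r (map (\<lambda>g. g xs) (h # map (\<lambda>i xs. xs ! i) [0..<n])) =
      rec_nat (f xs) (\<lambda>k r. g k r xs) (h xs)" if "length xs = n" for xs
  proof -
    have xs: "map (\<lambda>i. xs ! i) [0..<n] = xs" using that map_nth[of xs] by simp
    have "rec_nat (f' xs) (\<lambda>k r. g' (k # r # xs)) y = rec_nat (f xs) (\<lambda>k r. g k r xs) y" for y
      by (induction y) (use that f'(2) g'(2) in auto)
    then show ?thesis by (simp add: r_def comp_def xs)
  qed
  ultimately show ?thesis by (rule computable_congD)
qed

lemma computable_add:
  assumes "computable n f" "computable n g"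
  shows "computable n (\<lambda>xs. f xs + g xs)"
proof -
  have "rec_nat x (\<lambda>k r. Suc r) y = x + y" for x y :: nat by (induction y) auto
  moreover have "computable n (\<lambda>xs. rec_nat (f xs) (\<lambda>k r. Suc r) (g xs))"
    using assms by (intro computable_rec[of n f "\<lambda>k r xs. Suc r"] computable_Suc computable_nth) auto
  ultimately show ?thesis by simp
qed

lemma computable_mult:
  assumes "computable n f" "computable n g"
  shows "computable n (\<lambda>xs. f xs * g xs)"
proof -
  have "computable 2 (\<lambda>xs. rec_nat 0 (\<lambda>k r. r + xs ! 0) (xs ! 1))"
    by (intro computable_rec[where g = "\<lambda>k r xs. r + xs ! 0"] computable_const computable_add
        computable_nth computable_nth_tl) auto
  moreover have "rec_nat 0 (\<lambda>k r. r + x) y = x * y" for x y :: nat by (induction y) auto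
  ultimately have "computable 2 (\<lambda>xs. xs ! 0 * xs ! 1)" by simp
  then show ?thesis using assms by (rule computable_comp2)
qed

lemma computable_pred: "computable n f \<Longrightarrow> computable n (\<lambda>xs. f xs - 1)"
proof -
  assume "computable n f"
  then have "computable n (\<lambda>xs. rec_nat 0 (\<lambda>k r. k) (f xs))"
    by (intro computable_rec[where g = "\<lambda>k r xs. k"] computable_const computable_nth) auto
  moreover have "rec_nat 0 (\<lambda>k r. k) y = y - 1" for y :: nat by (cases y) auto
  ultimately show ?thesis by simp
qed

lemma computable_diff:
  assumes "computable n f" "computable n g"
  shows "computable n (\<lambda>xs. f xs - g xs)"
proof -
  have "computable n (\<lambda>xs. rec_nat (f xs) (\<lambda>k r. r - 1) (g xs))"
    using assms by (intro computable_rec[where g = "\<lambda>k r xs. r - 1"] computable_pred computable_nth) auto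
  moreover have "rec_nat x (\<lambda>k r. r - 1) y = x - y" for x y :: nat by (induction y) auto
  ultimately show ?thesis by simp
qed

lemma decidable_not: "decidable n P \<Longrightarrow> decidable n (\<lambda>xs. \<not> P xs)"
proof -
  assume "decidable n P"
  moreover have "of_bool (\<not> p) = 1 - (of_bool p :: nat)" for p by simp
  ultimately show ?thesis
    unfolding decidable_def by (simp only:) (intro computable_diff computable_const)
qed

lemma decidable_conj: "decidable n P \<Longrightarrow> decidable n Q \<Longrightarrow> decidable n (\<lambda>xs. P xs \<and> Q xs)"
  unfolding decidable_def of_bool_conj by (intro computable_mult)

lemma decidable_disj: "decidable n P \<Longrightarrow> decidable n Q \<Longrightarrow> decidable n (\<lambda>xs. P xs \<or> Q xs)"
  using decidable_not[OF decidable_conj[OF decidable_not decidable_not], of n P Q] by simp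

lemma decidable_const: "decidable n (\<lambda>xs. P)"
  unfolding decidable_def by (rule computable_const)

lemma decidable_less:
  assumes "computable n f" "computable n g"
  shows "decidable n (\<lambda>xs. f xs < g xs)"
proof -
  have "of_bool (x < y) = 1 - (1 - (y - x))" for x y :: nat by auto
  then show ?thesis
    unfolding decidable_def by (simp only:) (intro computable_diff computable_const assms)
qed

lemma decidable_le: "computable n f \<Longrightarrow> computable n g \<Longrightarrow> decidable n (\<lambda>xs. f xs \<le> g xs)"
  using decidable_not[OF decidable_less, of n g f] by (simp add: not_less)

lemma decidable_eq: "computable n f \<Longrightarrow> computable n g \<Longrightarrow> decidable n (\<lambda>xs. f xs = g xs)"
  unfolding eq_iff by (intro decidable_conj decidable_le)

lemma computable_if:
  assumes "decidable n P" "computable n f" "computable n g"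
  shows "computable n (\<lambda>xs. if P xs then f xs else g xs)"
proof -
  have "(if p then x else y) = of_bool p * x + (1 - of_bool p) * y" for p and x y :: nat by simp
  then show ?thesis
    using assms unfolding decidable_def
    by (simp only:) (intro computable_add computable_mult computable_diff computable_const)
qed

lemma decidable_ex_less:
  assumes P: "decidable (Suc n) (\<lambda>ys. P (ys ! 0) (tl ys))" and b: "computable n b"
  shows "decidable n (\<lambda>xs. \<exists>y<b xs. P y xs)"
proof -
  have P': "decidable (Suc (Suc n)) (\<lambda>ys. P (ys ! 0) (tl (tl ys)))"
  proof -
    have "computable (Suc (Suc n)) (\<lambda>ys. (\<lambda>ys. of_bool (P (ys ! 0) (tl ys)))
       (map (\<lambda>g. g ys) ((\<lambda>ys. ys ! 0) # map (\<lambda>i ys. ys ! Suc (Suc i)) [0..<n])))"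
      using P unfolding decidable_def by (intro computable_compose) (auto intro: computable_nth)
    then show ?thesis
      unfolding decidable_def
    proof (rule computable_congD)
      fix ys :: "nat list" assume "length ys = Suc (Suc n)"
      then have "map (\<lambda>g. g ys) (map (\<lambda>i ys. ys ! Suc (Suc i)) [0..<n]) = tl (tl ys)"
        by (intro nth_equalityI) (auto simp: nth_tl)
      then show "(\<lambda>ys. of_bool (P (ys ! 0) (tl ys)))
          (map (\<lambda>g. g ys) ((\<lambda>ys. ys ! 0) # map (\<lambda>i ys. ys ! Suc (Suc i)) [0..<n])) =
          (of_bool (P (ys ! 0) (tl (tl ys))) :: nat)" by simp
    qed
  qed
  have "computable n (\<lambda>xs. rec_nat 0 (\<lambda>k r. of_bool (P k xs \<or> 0 < r)) (b xs))"
    by (rule computable_rec[where g = "\<lambda>k r xs. of_bool (P k xs \<or> 0 < r)", OF computable_const _ b],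
        fold decidable_def, intro decidable_disj P' decidable_less computable_const computable_nth) auto
  moreover have "rec_nat 0 (\<lambda>k r. of_bool (P k xs \<or> 0 < r)) y = (of_bool (\<exists>k<y. P k xs) :: nat)" for xs y
    by (induction y) (auto simp: less_Suc_eq)
  ultimately show ?thesis unfolding decidable_def by simp
qed

lemma decidable_all_less:
  assumes "decidable (Suc n) (\<lambda>ys. P (ys ! 0) (tl ys))" "computable n b"
  shows "decidable n (\<lambda>xs. \<forall>y<b xs. P y xs)"
  using decidable_not[OF decidable_ex_less[OF decidable_not[OF assms(1)] assms(2)]] by simp

lemma computable_Least:
  assumes P: "decidable (Suc n) (\<lambda>ys. P (ys ! 0) (tl ys))"
    and ex: "\<And>xs. length xs = n \<Longrightarrow> \<exists>y. P y xs"
  shows "computable n (\<lambda>xs. LEAST y. P y xs)"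
proof -
  obtain f where f: "recursive (Suc n) f"
    "\<And>ys. length ys = Suc n \<Longrightarrow> f ys = of_bool (\<not> P (ys ! 0) (tl ys))"
    using decidable_not[OF P] by (auto simp: decidable_def computable_def)
  then have eq: "f (y # xs) = 0 \<longleftrightarrow> P y xs" if "length xs = n" for y xs using that by simp
  have "recursive n (\<lambda>xs. LEAST y. f (y # xs) = 0)"
    using f(1) ex eq by (intro recursive_mu) auto
  then have "computable n (\<lambda>xs. LEAST y. f (y # xs) = 0)" by (rule recursive_imp_computable)
  then show ?thesis by (rule computable_congD) (simp add: eq)
qed

lemma decidable_finite: "finite F \<Longrightarrow> computable n f \<Longrightarrow> decidable n (\<lambda>xs. f xs \<in> F)"
proof (induction F rule: finite_induct)
  case (insert x F)
  then show ?case using decidable_disj[OF decidable_eq[OF _ computable_const, of n f x]] by simp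
qed (simp add: decidable_const)

lemma computable_table:
  fixes h :: "nat \<Rightarrow> nat"
  assumes "finite F" "computable n f"
  shows "computable n (\<lambda>xs. if f xs \<in> F then h (f xs) else 0)"
  using assms
proof (induction F rule: finite_induct)
  case (insert x F)
  have "computable n (\<lambda>xs. if f xs = x then h x else if f xs \<in> F then h (f xs) else 0)"
    by (rule computable_if[OF decidable_eq[OF insert.prems computable_const] computable_const
        insert.IH[OF insert.prems]])
  moreover have "(\<lambda>xs. if f xs = x then h x else if f xs \<in> F then h (f xs) else 0) =
     (\<lambda>xs. if f xs \<in> insert x F then h (f xs) else 0)" by auto
  ultimately show ?case by simp
qed (simp add: computable_const)

lemmas computable_intros = computable_nth computable_nth_tl computable_Suc computable_const computable_add
  computable_mult computable_diff computable_if decidable_not decidable_conj decidable_disj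
  decidable_const decidable_less decidable_le decidable_eq decidable_ex_less
  decidable_all_less decidable_finite

section \<open>Computing with codes of pairs and lists\<close>

lemma computable_prod_encode:
  assumes "computable n f" "computable n g"
  shows "computable n (\<lambda>xs. prod_encode (f xs, g xs))"
proof -
  have "computable 1 (\<lambda>xs. rec_nat 0 (\<lambda>k r. r + Suc k) (xs ! 0))"
    by (intro computable_rec[where g = "\<lambda>k r xs. r + Suc k"] computable_intros) auto
  moreover have "rec_nat 0 (\<lambda>k r. r + Suc k) y = triangle y" for y
    by (induction y) auto
  ultimately have "computable 1 (\<lambda>xs. triangle (xs ! 0))" by simp
  from computable_add[OF computable_comp1[OF this computable_add[OF assms]] assms(1)]
  show ?thesis by (simp add: prod_encode_def)
qed

lemma computable_prod_decode:
  assumes "computable n f"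
  shows "computable n (\<lambda>xs. fst (prod_decode (f xs)))" "computable n (\<lambda>xs. snd (prod_decode (f xs)))"
proof -
  have "(LEAST a. \<exists>b<Suc c. prod_encode (a, b) = c) = fst (prod_decode c)" for c
  proof (rule Least_equality)
    have "prod_encode (fst (prod_decode c), snd (prod_decode c)) = c" by simp
    moreover from this have "snd (prod_decode c) < Suc c"
      using le_prod_encode_2[of "snd (prod_decode c)" "fst (prod_decode c)"] by simp
    ultimately show "\<exists>b<Suc c. prod_encode (fst (prod_decode c), b) = c" by blast
  qed auto
  moreover have "computable 1 (\<lambda>xs. LEAST a. \<exists>b<Suc (xs ! 0). prod_encode (a, b) = xs ! 0)"
  proof (rule computable_Least)
    show "decidable (Suc 1) (\<lambda>ys. \<exists>b<Suc (tl ys ! 0). prod_encode (ys ! 0, b) = tl ys ! 0)"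
      by (intro computable_intros computable_prod_encode) auto
    fix xs :: "nat list"
    have "prod_encode (fst (prod_decode (xs ! 0)), snd (prod_decode (xs ! 0))) = xs ! 0" by simp
    moreover from this have "snd (prod_decode (xs ! 0)) < Suc (xs ! 0)"
      using le_prod_encode_2[of "snd (prod_decode (xs ! 0))" "fst (prod_decode (xs ! 0))"] by simp
    ultimately show "\<exists>a. \<exists>b<Suc (xs ! 0). prod_encode (a, b) = xs ! 0" by blast
  qed
  ultimately have 1: "computable 1 (\<lambda>xs. fst (prod_decode (xs ! 0)))" by simp
  show "computable n (\<lambda>xs. fst (prod_decode (f xs)))"
    by (rule computable_comp1[OF 1 assms])
  have "(LEAST b. prod_encode (fst (prod_decode c), b) = c) = snd (prod_decode c)" for c
    by (rule Least_equality) (auto, metis prod_decode_inverse prod_encode_inverse snd_conv order_refl)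
  moreover have "computable 1 (\<lambda>xs. LEAST b. prod_encode (fst (prod_decode (xs ! 0)), b) = xs ! 0)"
  proof (rule computable_Least)
    show "decidable (Suc 1) (\<lambda>ys. prod_encode (fst (prod_decode (tl ys ! 0)), ys ! 0) = tl ys ! 0)"
      by (intro computable_intros computable_prod_encode computable_comp1[OF 1]) auto
    show "\<exists>b. prod_encode (fst (prod_decode (xs ! 0)), b) = xs ! 0" for xs
      by (metis prod.collapse prod_decode_inverse)
  qed
  ultimately have 2: "computable 1 (\<lambda>xs. snd (prod_decode (xs ! 0)))" by simp
  show "computable n (\<lambda>xs. snd (prod_decode (f xs)))"
    by (rule computable_comp1[OF 2 assms])
qed

text \<open>
Lists are handled through their length and their entries: a list operation is then computed by
minimization, as the only code with the right length and entries.
\<close>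

definition entry :: "nat \<Rightarrow> nat \<Rightarrow> nat" where
  "entry c i = (if i < length (list_decode c) then list_decode c ! i else 0)"

lemma list_code_cases: obtains xs where "c = list_encode xs"
  by (metis list_decode_inverse)

lemma drop_code:
  "rec_nat (list_encode xs) (\<lambda>k r. if r = 0 then 0 else snd (prod_decode (r - 1))) i = list_encode (drop i xs)"
proof (induction i)
  case (Suc i)
  then show ?case
    by (cases "drop i xs") (auto simp: drop_Suc drop_tl tl_drop)
qed simp

lemma computable_drop_code:
  assumes "computable n f" "computable n g"
  shows "computable n (\<lambda>xs. list_encode (drop (g xs) (list_decode (f xs))))"
proof -
  have "computable n (\<lambda>xs. rec_nat (f xs) (\<lambda>k r. if r = 0 then 0 else snd (prod_decode (r - 1))) (g xs))"
    using assms
    by (intro computable_rec[where g = "\<lambda>k r xs. if r = 0 then 0 else snd (prod_decode (r - 1))"]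
       computable_intros computable_prod_decode) auto
  moreover have "rec_nat c (\<lambda>k r. if r = 0 then 0 else snd (prod_decode (r - 1))) i =
     list_encode (drop i (list_decode c))" for c i
    using drop_code[of "list_decode c" i] by simp
  ultimately show ?thesis by simp
qed

lemma computable_length:
  assumes "computable n f"
  shows "computable n (\<lambda>xs. length (list_decode (f xs)))"
proof -
  have "computable 1 (\<lambda>xs. LEAST i. list_encode (drop i (list_decode (xs ! 0))) = 0)"
  proof (rule computable_Least)
    show "decidable (Suc 1) (\<lambda>ys. list_encode (drop (ys ! 0) (list_decode (tl ys ! 0))) = 0)"
      by (intro computable_intros computable_drop_code) auto
    show "\<exists>i. list_encode (drop i (list_decode (xs ! 0))) = 0" for xs
      by (rule exI[of _ "length (list_decode (xs ! 0))"]) simp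
  qed
  moreover have "(LEAST i. list_encode (drop i ys) = 0) = length ys" for ys
  proof (rule Least_equality)
    fix i assume "list_encode (drop i ys) = 0"
    then show "length ys \<le> i" by (cases "drop i ys") auto
  qed simp
  ultimately have "computable 1 (\<lambda>xs. length (list_decode (xs ! 0)))" by simp
  then show ?thesis using assms by (rule computable_comp1)
qed

lemma computable_entry:
  assumes "computable n f" "computable n g"
  shows "computable n (\<lambda>xs. entry (f xs) (g xs))"
proof -
  have "entry c i = (if i < length (list_decode c)
      then fst (prod_decode (list_encode (drop i (list_decode c)) - 1)) else 0)" for c i
    by (simp add: entry_def flip: Cons_nth_drop_Suc)
  then show ?thesis
    using assms
    by (simp only:) (intro computable_intros computable_length computable_prod_decode computable_drop_code)
qed

lemma Least_eq_self: "(LEAST c. c = a) = (a :: nat)"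
  by (rule Least_equality) auto

lemma list_code_eqI:
  assumes "length (list_decode c) = length xs" "\<And>i. i < length xs \<Longrightarrow> entry c i = xs ! i"
  shows "c = list_encode xs"
proof -
  have "list_decode c = xs"
    using assms by (intro nth_equalityI) (auto simp: entry_def)
  then show ?thesis by (metis list_decode_inverse)
qed

lemma computable_append:
  assumes "computable n f" "computable n g"
  shows "computable n (\<lambda>xs. list_encode (list_decode (f xs) @ list_decode (g xs)))"
proof -
  let ?len = "\<lambda>c. length (list_decode c)"
  define P where "P = (\<lambda>c xs. ?len c = ?len (xs ! 0) + ?len (xs ! 1) \<and>
     (\<forall>i<?len (xs ! 0). entry c i = entry (xs ! 0) i) \<and>
     (\<forall>i<?len (xs ! 1). entry c (?len (xs ! 0) + i) = entry (xs ! 1) i))"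
  have P_iff: "P c xs \<longleftrightarrow> c = list_encode (list_decode (xs ! 0) @ list_decode (xs ! 1))" for c xs
  proof
    assume P: "P c xs"
    show "c = list_encode (list_decode (xs ! 0) @ list_decode (xs ! 1))"
    proof (rule list_code_eqI)
      fix i assume i: "i < length (list_decode (xs ! 0) @ list_decode (xs ! 1))"
      show "entry c i = (list_decode (xs ! 0) @ list_decode (xs ! 1)) ! i"
      proof (cases "i < ?len (xs ! 0)")
        case True
        then have "entry c i = entry (xs ! 0) i" using P by (simp add: P_def)
        then show ?thesis using True by (simp add: entry_def nth_append)
      next
        case False
        then obtain j where "i = ?len (xs ! 0) + j" "j < ?len (xs ! 1)"
          using i by (metis add_diff_inverse_nat length_append nat_add_left_cancel_less)
        moreover from this have "entry c i = entry (xs ! 1) j" using P by (simp add: P_def)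
        ultimately show ?thesis by (simp add: entry_def)
      qed
    qed (use P in \<open>simp add: P_def\<close>)
  qed (auto simp: P_def entry_def nth_append)
  have "computable 2 (\<lambda>xs. LEAST c. P c xs)"
  proof (rule computable_Least)
    show "decidable (Suc 2) (\<lambda>ys. P (ys ! 0) (tl ys))"
      unfolding P_def by (intro computable_intros computable_length computable_entry) auto
  qed (auto simp: P_iff)
  then have "computable 2 (\<lambda>xs. list_encode (list_decode (xs ! 0) @ list_decode (xs ! 1)))"
    by (simp add: P_iff Least_eq_self)
  then show ?thesis using assms by (rule computable_comp2)
qed

lemma computable_map:
  assumes h: "computable 1 (\<lambda>xs. h (xs ! 0))" and f: "computable n f"
  shows "computable n (\<lambda>xs. list_encode (map h (list_decode (f xs))))"
proof -
  let ?len = "\<lambda>c. length (list_decode c)"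
  define P where "P = (\<lambda>c xs. ?len c = ?len (xs ! 0) \<and>
     (\<forall>i<?len (xs ! 0). entry c i = h (entry (xs ! 0) i)))"
  have P_iff: "P c xs \<longleftrightarrow> c = list_encode (map h (list_decode (xs ! 0)))" for c xs
  proof
    assume "P c xs"
    then show "c = list_encode (map h (list_decode (xs ! 0)))"
      by (intro list_code_eqI) (auto simp: P_def entry_def)
  qed (auto simp: P_def entry_def)
  have "computable 1 (\<lambda>xs. LEAST c. P c xs)"
  proof (rule computable_Least)
    show "decidable (Suc 1) (\<lambda>ys. P (ys ! 0) (tl ys))"
      unfolding P_def by (intro computable_intros computable_length computable_entry computable_comp1[OF h]) auto
  qed (auto simp: P_iff)
  then have "computable 1 (\<lambda>xs. list_encode (map h (list_decode (xs ! 0))))"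
    by (simp add: P_iff Least_eq_self)
  then show ?thesis using f by (rule computable_comp1)
qed

lemma decidable_set_subset:
  assumes "finite F" "computable n f"
  shows "decidable n (\<lambda>xs. set (list_decode (f xs)) \<subseteq> F)"
proof -
  have "set (list_decode c) \<subseteq> F \<longleftrightarrow> (\<forall>i<length (list_decode c). entry c i \<in> F)" for c
    by (auto simp: entry_def subset_iff in_set_conv_nth)
  moreover have "decidable 1 (\<lambda>xs. \<forall>i<length (list_decode (xs ! 0)). entry (xs ! 0) i \<in> F)"
    using assms(1) by (intro computable_intros computable_length computable_entry) auto
  ultimately have "decidable 1 (\<lambda>xs. set (list_decode (xs ! 0)) \<subseteq> F)" by simp
  then show ?thesis using assms(2) by (rule decidable_comp1)
qed

lemma prod_encode_mono: "a \<le> a' \<Longrightarrow> b \<le> b' \<Longrightarrow> prod_encode (a, b) \<le> prod_encode (a', b')"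
  unfolding prod_encode_def triangle_def
  by (auto intro!: add_mono div_le_mono mult_le_mono)

text \<open>
The encoding is monotone in the entries and the length, so a search among the lists over a finite
alphabet of bounded length is a bounded search among codes.
\<close>

lemma list_encode_bound:
  assumes "set xs \<subseteq> {..M}" "length xs \<le> k"
  shows "list_encode xs \<le> list_encode (replicate k M)"
  using assms
proof (induction k arbitrary: xs)
  case (Suc k)
  then show ?case by (cases xs) (auto intro: prod_encode_mono)
qed simp

lemma decidable_ex_list:
  assumes F: "finite F" and P: "decidable (Suc n) (\<lambda>ys. P (ys ! 0) (tl ys))" and b: "computable n b"
  shows "decidable n (\<lambda>xs. \<exists>c. set (list_decode c) \<subseteq> F \<and> length (list_decode c) \<le> b xs \<and> P c xs)"
proof -
  define M where "M = Max (insert 0 F)"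
  have M: "F \<subseteq> {..M}" using F by (auto simp: M_def)
  define B where "B = (\<lambda>k. rec_nat 0 (\<lambda>_ r. Suc (prod_encode (M, r))) k)"
  have B: "B k = list_encode (replicate k M)" for k
    by (induction k) (auto simp: B_def)
  have bound: "c < Suc (B k)" if "set (list_decode c) \<subseteq> F" "length (list_decode c) \<le> k" for c k
    using list_encode_bound[OF subset_trans[OF that(1) M] that(2)] by (simp add: B)
  have Bc: "computable n (\<lambda>xs. B (b xs))"
    unfolding B_def
    by (intro computable_rec[where g = "\<lambda>k r xs. Suc (prod_encode (M, r))"] b
        computable_intros computable_prod_encode) auto
  note b' = computable_tl[OF b]
  have "decidable n (\<lambda>xs. \<exists>c<Suc (B (b xs)). set (list_decode c) \<subseteq> F \<and> length (list_decode c) \<le> b xs \<and> P c xs)"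
    by (intro decidable_ex_less decidable_conj P decidable_set_subset F decidable_le computable_length
        b' computable_Suc Bc computable_nth) auto
  moreover have "(\<exists>c<Suc (B (b xs)). set (list_decode c) \<subseteq> F \<and> length (list_decode c) \<le> b xs \<and> P c xs) \<longleftrightarrow>
     (\<exists>c. set (list_decode c) \<subseteq> F \<and> length (list_decode c) \<le> b xs \<and> P c xs)" for xs
    using bound by blast
  ultimately show ?thesis by simp
qed

section \<open>Normal forms of a decidable terminating relation\<close>

text \<open>
The function searches for the code of a complete reduction sequence, from its argument to an
irreducible element. Such a sequence exists for every argument by termination, so the unbounded
search is total; its length needs no a priori bound.
\<close>

lemma computable_normal_form:
  fixes \<mu> :: "nat \<Rightarrow> nat"
  assumes step: "decidable 2 (\<lambda>xs. step (xs ! 0) (xs ! 1))"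
    and irred: "decidable 1 (\<lambda>xs. \<nexists>c. step (xs ! 0) c)"
    and \<mu>: "\<And>c c'. step c c' \<Longrightarrow> \<mu> c' < \<mu> c"
  obtains nf where "computable 1 (\<lambda>xs. nf (xs ! 0))" "\<And>c. step\<^sup>*\<^sup>* c (nf c)" "\<And>c c'. \<not> step (nf c) c'"
proof -
  let ?len = "\<lambda>c. length (list_decode c)"
  define chain where "chain = (\<lambda>d c. 0 < ?len d \<and> entry d 0 = c \<and>
     (\<forall>i<?len d - 1. step (entry d i) (entry d (Suc i))) \<and> (\<nexists>c'. step (entry d (?len d - 1)) c'))"
  have ex: "\<exists>d. chain d c" for c
  proof (induction "\<mu> c" arbitrary: c rule: less_induct)
    case less
    show ?case
    proof (cases "\<exists>c'. step c c'")
      case False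
      have "chain (list_encode [c]) c"
        unfolding chain_def entry_def list_encode_inverse using False by simp
      then show ?thesis ..
    next
      case True
      then obtain c' where c': "step c c'" by blast
      with less[OF \<mu>] obtain d where d: "chain d c'" by blast
      obtain xs where xs: "d = list_encode xs" by (rule list_code_cases)
      have "chain (list_encode (c # xs)) c"
        using d c' unfolding chain_def entry_def xs list_encode_inverse
        by (auto simp: nth_Cons less_Suc_eq_0_disj split: nat.split)
      then show ?thesis ..
    qed
  qed
  define nf where "nf = (\<lambda>c. let d = LEAST d. chain d c in entry d (?len d - 1))"
  have chain: "chain (LEAST d. chain d c) c" for c
    using ex by (rule LeastI_ex)
  show ?thesis
  proof (rule that[of nf])
    have "decidable (Suc 1) (\<lambda>ys. chain (ys ! 0) (tl ys ! 0))"
      unfolding chain_def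
      by (intro computable_intros computable_length computable_entry decidable_comp2[OF step]
          decidable_comp1[OF irred]) auto
    then have L: "computable 1 (\<lambda>xs. LEAST d. chain d (xs ! 0))"
      using ex by (rule computable_Least)
    show "computable 1 (\<lambda>xs. nf (xs ! 0))"
      unfolding nf_def Let_def by (intro L computable_entry computable_length computable_diff computable_const)
    fix c
    define d where "d = (LEAST d. chain d c)"
    have d: "0 < ?len d" "entry d 0 = c" "\<And>i. i < ?len d - 1 \<Longrightarrow> step (entry d i) (entry d (Suc i))"
      "\<nexists>c'. step (entry d (?len d - 1)) c'"
      using chain[of c] unfolding d_def chain_def by blast+
    have nf: "nf c = entry d (?len d - 1)" by (simp add: nf_def d_def Let_def)
    show "\<not> step (nf c) c'" for c' using d(4) nf by auto
    have "step\<^sup>*\<^sup>* c (entry d i)" if "i \<le> ?len d - 1" for i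
      using that by (induction i) (use d(2,3) in \<open>auto intro: rtranclp.rtrancl_into_rtrancl\<close>)
    then show "step\<^sup>*\<^sup>* c (nf c)" using nf by simp
  qed
qed

section \<open>The word problem for numbered generators\<close>

definition letter_code :: "nat \<times> bool \<Rightarrow> nat" where
  "letter_code l = 2 * fst l + of_bool (snd l)"

definition letters :: "nat set \<Rightarrow> nat set" where
  "letters Y = letter_code ` (Y \<times> UNIV)"

definition word_code :: "nat word \<Rightarrow> nat" where
  "word_code w = list_encode (map letter_code w)"

text \<open>
The word problem with the fixed numbering \<open>letter_code\<close>, which is onto: every number is the code of
a word.
\<close>

definition word_decidable :: "nat set \<Rightarrow> (nat \<Rightarrow> nat \<Rightarrow> enat) \<Rightarrow> bool" where
  "word_decidable S m \<longleftrightarrow> (\<exists>P. decidable 1 (\<lambda>xs. P (xs ! 0)) \<and>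
     (\<forall>w\<in>words S. P (word_code w) \<longleftrightarrow> artin_eq S m w []))"

lemma letter_code_inverse: "(letter_code l div 2, odd (letter_code l)) = l"
  by (cases l) (auto simp: letter_code_def)

lemma inj_letter_code: "inj letter_code"
  by (rule injI) (metis letter_code_inverse)

lemma finite_letters: "finite Y \<Longrightarrow> finite (letters Y)"
  by (simp add: letters_def)

lemma letter_code_in_letters: "letter_code l \<in> letters Y \<longleftrightarrow> fst l \<in> Y"
  using inj_image_mem_iff[OF inj_letter_code, of l "Y \<times> UNIV"] by (cases l) (auto simp: letters_def)

lemma list_decode_word_code [simp]: "list_decode (word_code w) = map letter_code w"
  by (simp add: word_code_def)

lemma word_code_inj: "word_code u = word_code v \<longleftrightarrow> u = v"
  by (metis inj_letter_code inj_map_eq_map list_decode_word_code)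

lemma word_code_surj: obtains w where "c = word_code w"
proof -
  have "2 * (a div 2) + of_bool (odd a) = a" for a :: nat by (cases "even a") auto
  then have "c = word_code (map (\<lambda>a. (a div 2, odd a)) (list_decode c))"
    by (simp add: word_code_def comp_def letter_code_def)
  then show ?thesis by (rule that)
qed

lemma set_word_code_subset: "set (list_decode (word_code w)) \<subseteq> letters Y \<longleftrightarrow> w \<in> words Y"
  by (induction w) (auto simp: letter_code_in_letters)

lemma word_value_pres_gen:
  "w \<in> words X \<Longrightarrow> word_value (presented_group X R) (map (apfst (pres_gen X R)) w) = pres_class X R w"
proof (induction w)
  case (Cons l w)
  obtain x b where l: "l = (x, b)" by (cases l)
  then have x: "x \<in> X" using Cons.prems by simp
  have val: "(if b then pres_gen X R x else inv\<^bsub>presented_group X R\<^esub> (pres_gen X R x)) = pres_class X R [(x, b)]"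
    using inv_pres_gen[OF x, of R] by (cases b) (simp_all add: pres_gen_def)
  have "word_value (presented_group X R) (map (apfst (pres_gen X R)) (l # w)) =
      pres_class X R [(x, b)] \<otimes>\<^bsub>presented_group X R\<^esub> pres_class X R w"
    using Cons by (simp add: l flip: val)
  also have "\<dots> = pres_class X R (l # w)"
    using pres_mult[of "[(x, b)]" X w R] Cons.prems x by (simp add: l)
  finally show ?case .
qed (simp add: one_presented_group)

lemma word_value_artin:
  assumes "w \<in> words S"
  shows "word_value (artin_group S m) (map (apfst (pres_gen S (artin_relations S m))) w) = \<one>\<^bsub>artin_group S m\<^esub>
    \<longleftrightarrow> artin_eq S m w []"
  using assms by (simp add: artin_group_def word_value_pres_gen one_presented_group pres_class_eq_iff)

text \<open>
The given numbering differs from the fixed one by a table on the finitely many letters.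
\<close>

lemma solvable_imp_word_decidable:
  assumes "finite S" "solvable_word_problem (artin_group S m) (artin_generators S m)"
  shows "word_decidable S m"
proof -
  let ?gen = "pres_gen S (artin_relations S m)"
  obtain code f where f: "recursive 1 f" and code: "\<And>w. w \<in> words (artin_generators S m) \<Longrightarrow>
     f [list_encode (map code w)] = (if word_value (artin_group S m) w = \<one>\<^bsub>artin_group S m\<^esub> then 1 else 0)"
    using assms(2) unfolding solvable_word_problem_def by blast
  define h where "h = (\<lambda>a. if a \<in> letters S then code (?gen (a div 2), odd a) else 0)"
  have h: "computable 1 (\<lambda>xs. h (xs ! 0))"
    unfolding h_def using assms(1)
    by (intro computable_table[where h = "\<lambda>a. code (?gen (a div 2), odd a)"] finite_letters computable_nth) auto
  have f': "computable 1 (\<lambda>xs. f [xs ! 0])"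
    by (rule computable_congD[OF recursive_imp_computable[OF f]]) (auto simp: length_Suc_conv)
  define P where "P = (\<lambda>c. f [list_encode (map h (list_decode c))] = 1)"
  have "decidable 1 (\<lambda>xs. P (xs ! 0))"
    unfolding P_def
    by (intro decidable_eq computable_const computable_comp1[OF f'] computable_map h computable_nth) simp
  moreover have "P (word_code w) \<longleftrightarrow> artin_eq S m w []" if w: "w \<in> words S" for w
  proof -
    have "h (letter_code l) = code (apfst ?gen l)" if "fst l \<in> S" for l
    proof -
      have "h (letter_code l) = code (apfst ?gen (letter_code l div 2, odd (letter_code l)))"
        using that by (simp add: h_def letter_code_in_letters)
      then show ?thesis unfolding letter_code_inverse .
    qed
    then have eq: "map h (map letter_code w) = map code (map (apfst ?gen) w)"
      using w by (induction w) auto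
    have "map (apfst ?gen) w \<in> words (artin_generators S m)"
      using w by (induction w) (auto simp: artin_generators_def)
    from code[OF this] show ?thesis
      unfolding P_def list_decode_word_code eq word_value_artin[OF w] by simp
  qed
  ultimately show ?thesis unfolding word_decidable_def by blast
qed

lemma artin_eq_map:
  assumes "artin_eq S m u v" "inj_on h S" "\<And>s t. s \<in> S \<Longrightarrow> t \<in> S \<Longrightarrow> m' (h s) (h t) = m s t"
  shows "artin_eq (h ` S) m' (map (apfst h) u) (map (apfst h) v)"
proof (rule pres_eq_map[OF assms(1)])
  fix l r assume "(l, r) \<in> artin_relations S m"
  then obtain s t k where st: "l = alt (s, True) (t, True) k" "r = alt (t, True) (s, True) k"
    "s \<in> S" "t \<in> S" "s \<noteq> t" "m s t = enat k"
    by (auto simp: artin_relations_def alternating_eq_alt)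
  have "h s \<noteq> h t" using st assms(2) by (auto dest: inj_onD)
  moreover have "m' (h s) (h t) = enat k" using st assms(3) by simp
  ultimately show "(map (apfst h) l, map (apfst h) r) \<in> artin_relations (h ` S) m'"
    using st(3,4) unfolding artin_relations_def alternating_eq_alt st(1,2) map_alt by fastforce
qed auto

text \<open>
The letters of the given group are group elements, so each must first be assigned one of the
vertices that it comes from.
\<close>

lemma word_decidable_imp_solvable:
  fixes S :: "'v set" and m' :: "nat \<Rightarrow> nat \<Rightarrow> enat"
  assumes h: "inj_on h S" and m': "\<And>s t. s \<in> S \<Longrightarrow> t \<in> S \<Longrightarrow> m' (h s) (h t) = m s t"
    and dec: "word_decidable (h ` S) m'"
  shows "solvable_word_problem (artin_group S m) (artin_generators S m)"
proof -
  let ?gen = "pres_gen S (artin_relations S m)"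
  define sel where "sel = inv_into S ?gen"
  have sel: "sel g \<in> S" "?gen (sel g) = g" if "g \<in> artin_generators S m" for g
    using that by (auto simp: sel_def artin_generators_def inv_into_into f_inv_into_f)
  define code where "code = (\<lambda>l. letter_code (apfst h (apfst sel l)))"
  have "inj_on code (artin_generators S m \<times> UNIV)"
  proof (rule inj_onI)
    fix l l' assume *: "l \<in> artin_generators S m \<times> UNIV" "l' \<in> artin_generators S m \<times> UNIV" "code l = code l'"
    obtain g b g' b' where l: "l = (g, b)" "l' = (g', b')" by (cases l; cases l')
    then have g: "g \<in> artin_generators S m" "g' \<in> artin_generators S m" using * by auto
    have "apfst h (apfst sel l) = apfst h (apfst sel l')"
      using *(3) unfolding code_def by (rule injD[OF inj_letter_code])
    then have "h (sel g) = h (sel g')" "b = b'" using l by auto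
    then have "sel g = sel g'" using h sel(1)[OF g(1)] sel(1)[OF g(2)] by (auto dest: inj_onD)
    then have "g = g'" using sel(2)[OF g(1)] sel(2)[OF g(2)] by metis
    then show "l = l'" using l \<open>b = b'\<close> by simp
  qed
  moreover obtain P where P: "decidable 1 (\<lambda>xs. P (xs ! 0))"
    "\<And>w. w \<in> words (h ` S) \<Longrightarrow> P (word_code w) \<longleftrightarrow> artin_eq (h ` S) m' w []"
    using dec unfolding word_decidable_def by blast
  obtain f where f: "recursive 1 f" "\<And>c. f [c] = of_bool (P c)"
    using P(1) unfolding decidable_def computable_def by force
  have "f [list_encode (map code w)] =
      (if word_value (artin_group S m) w = \<one>\<^bsub>artin_group S m\<^esub> then 1 else 0)"
    if w: "w \<in> words (artin_generators S m)" for w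
  proof -
    let ?w = "map (apfst sel) w"
    have w': "?w \<in> words S" "map (apfst ?gen) ?w = w"
      using w sel by (induction w) auto
    have hw: "map (apfst h) ?w \<in> words (h ` S)"
      using w'(1) by (induction w) auto
    have "list_encode (map code w) = word_code (map (apfst h) ?w)"
      by (simp add: word_code_def code_def comp_def)
    moreover have "artin_eq (h ` S) m' (map (apfst h) ?w) [] \<longleftrightarrow> artin_eq S m ?w []"
    proof
      assume "artin_eq S m ?w []"
      from artin_eq_map[OF this h m'] show "artin_eq (h ` S) m' (map (apfst h) ?w) []" by simp
    next
      let ?g = "inv_into S h"
      assume *: "artin_eq (h ` S) m' (map (apfst h) ?w) []"
      have "artin_eq (?g ` h ` S) m (map (apfst ?g) (map (apfst h) ?w)) (map (apfst ?g) [])"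
        using * by (rule artin_eq_map) (use h m' in \<open>auto simp: inj_on_inv_into\<close>)
      moreover have "?g ` h ` S = S" using h by (simp add: image_image)
      moreover have "map (apfst ?g) (map (apfst h) ?w) = ?w"
        using w'(1) h by (induction w) auto
      ultimately show "artin_eq S m ?w []" by (simp only: list.map)
    qed
    ultimately show ?thesis
      using P(2)[OF hw] f(2) word_value_artin[OF w'(1), of m] w'(2) by simp
  qed
  ultimately show ?thesis
    unfolding solvable_word_problem_def using f(1) by blast
qed

section \<open>Removing an infinite label\<close>

lemma artin_relations_words:
  "(l, r) \<in> artin_relations S m \<Longrightarrow> l \<in> words S \<and> r \<in> words S"
proof -
  have "alt (a, True) (b, True) k \<in> words S" if "a \<in> S" "b \<in> S" for a b k
    using that by (induction k arbitrary: a b) auto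
  then show "(l, r) \<in> artin_relations S m \<Longrightarrow> l \<in> words S \<and> r \<in> words S"
    by (auto simp: artin_relations_def alternating_eq_alt)
qed

lemma coxeter_matrix_subset: "coxeter_matrix S m \<Longrightarrow> X \<subseteq> S \<Longrightarrow> coxeter_matrix X m"
  unfolding coxeter_matrix_def by (meson finite_subset subsetD)

lemma artin_eq_parabolic:
  assumes "coxeter_matrix S m" "X \<subseteq> S" "w \<in> words X"
  shows "artin_eq S m w [] \<longleftrightarrow> artin_eq X m w []"
proof
  obtain \<pi> where \<pi>: "\<And>u v. artin_eq S m u v \<Longrightarrow> artin_eq X m (\<pi> u) (\<pi> v)"
    "\<And>u v. u \<in> words X \<Longrightarrow> \<pi> (u @ v) = u @ \<pi> v" "\<pi> [] = []"
    using artin_retraction[OF assms(1,2)] by metis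
  assume "artin_eq S m w []"
  then show "artin_eq X m w []"
    using \<pi>(1)[of w "[]"] \<pi>(2)[OF assms(3), of "[]"] \<pi>(3) by simp
next
  assume "artin_eq X m w []"
  then show "artin_eq S m w []" using assms(2) by (rule artin_eq_mono)
qed

text \<open>
The step relation replaces a factor \<open>p\<close> from one side, which is not over \<open>X\<close>, by an equal word over \<open>X\<close>
of at most the same length. It is decidable by bounded search, because the length is bounded. It
terminates, because the number of letters outside of \<open>X\<close> drops. It can be applied to
every trivial word that involves both sides, because the retraction provides the short word.
\<close>

lemma word_decidable_amalgam:
  fixes S :: "nat set"
  assumes S: "coxeter_matrix S m" and st: "s \<in> S" "t \<in> S" "m s t = \<infinity>"
    and dec: "word_decidable (S - {s}) m" "word_decidable (S - {t}) m"
  shows "word_decidable S m"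
proof -
  define gens where "gens = (\<lambda>i. if i then S - {s} else S - {t})"
  define X where "X = S - {s, t}"
  have "s \<noteq> t" using S st by (auto simp: coxeter_matrix_def)
  have fin: "finite S" using S by (simp add: coxeter_matrix_def)
  have X_gens: "X \<subseteq> gens i" and gens_S: "gens i \<subseteq> S" for i by (auto simp: X_def gens_def)
  have cox: "coxeter_matrix (gens i) m" for i by (rule coxeter_matrix_subset[OF S gens_S])
  have "\<exists>\<pi>. (\<forall>w. \<pi> w \<in> words X) \<and> (\<forall>w. length (\<pi> w) \<le> length w) \<and>
    (\<forall>u v. artin_eq (gens i) m u v \<longrightarrow> artin_eq X m (\<pi> u) (\<pi> v)) \<and>
    (\<forall>u v. u \<in> words X \<longrightarrow> \<pi> (u @ v) = u @ \<pi> v) \<and> \<pi> [] = []" for i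
    using artin_retraction[OF cox[of i] X_gens[of i]] by metis
  then obtain ret where ret: "\<And>i w. ret i w \<in> words X" "\<And>i w. length (ret i w) \<le> length w"
    "\<And>i u v. artin_eq (gens i) m u v \<Longrightarrow> artin_eq X m (ret i u) (ret i v)"
    "\<And>i u v. u \<in> words X \<Longrightarrow> ret i (u @ v) = u @ ret i v" "\<And>i. ret i [] = []"
    by metis
  interpret amalgam gens "\<lambda>i. artin_relations (gens i) m" X "artin_relations X m" ret
  proof
    show "gens True \<inter> gens False = X" by (auto simp: X_def gens_def)
  qed (simp_all add: artin_relations_words artin_eq_mono[OF _ X_gens] ret)
  have all_gens: "gens True \<union> gens False = S" using \<open>s \<noteq> t\<close> by (auto simp: gens_def)
  have m_sym: "m t s = \<infinity>" using S st \<open>s \<noteq> t\<close> unfolding coxeter_matrix_def by metis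
  have all_rels: "artin_relations (gens True) m \<union> artin_relations (gens False) m = artin_relations S m"
  proof
    show "artin_relations (gens True) m \<union> artin_relations (gens False) m \<subseteq> artin_relations S m"
      unfolding artin_relations_def gens_def by (simp, blast)
    show "artin_relations S m \<subseteq> artin_relations (gens True) m \<union> artin_relations (gens False) m"
    proof
      fix lr assume "lr \<in> artin_relations S m"
      then obtain a b k where ab: "lr = (alternating (a, True) (b, True) k, alternating (b, True) (a, True) k)"
        "a \<in> S" "b \<in> S" "a \<noteq> b" "m a b = enat k" unfolding artin_relations_def by blast
      have "(a \<in> gens True \<and> b \<in> gens True) \<or> (a \<in> gens False \<and> b \<in> gens False)"
        using ab st(3) m_sym \<open>s \<noteq> t\<close> by (auto simp: gens_def)
      then show "lr \<in> artin_relations (gens True) m \<union> artin_relations (gens False) m"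
        using ab unfolding artin_relations_def by blast
    qed
  qed
  have "\<exists>P. decidable 1 (\<lambda>xs. P (xs ! 0)) \<and>
     (\<forall>w\<in>words (gens i). P (word_code w) \<longleftrightarrow> artin_eq (gens i) m w [])" for i
    using dec by (cases i) (simp_all add: gens_def word_decidable_def)
  then obtain P where P: "\<And>i. decidable 1 (\<lambda>xs. P i (xs ! 0))"
    "\<And>i w. w \<in> words (gens i) \<Longrightarrow> P i (word_code w) \<longleftrightarrow> artin_eq (gens i) m w []"
    by metis

  let ?len = "\<lambda>c. length (list_decode c)"
  define over where "over = (\<lambda>Y c. set (list_decode c) \<subseteq> letters Y)"
  define cat where "cat = (\<lambda>a b. list_encode (list_decode a @ list_decode b))"
  have over: "over Y (word_code w) \<longleftrightarrow> w \<in> words Y" for Y w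
    by (simp only: over_def set_word_code_subset)
  have cat: "cat (word_code u) (word_code v) = word_code (u @ v)" for u v
    by (simp add: cat_def word_code_def)
  have ex_code: "(\<exists>c. Q c) \<longleftrightarrow> (\<exists>w. Q (word_code w))" for Q
    by (metis word_code_surj)
  have dec_over: "decidable n (\<lambda>xs. over Y (f xs))" if "computable n f" "Y \<subseteq> S" for n Y f
    unfolding over_def using that finite_subset[OF that(2) fin]
    by (intro decidable_set_subset finite_letters)
  have comp_cat: "computable n (\<lambda>xs. cat (f xs) (g xs))" if "computable n f" "computable n g" for n f g
    unfolding cat_def using that by (rule computable_append)

  \<comment> \<open>the witness \<open>y\<close> is an inverse of \<open>e\<close>: two tests for triviality replace the comparison of \<open>p\<close> and \<open>e\<close>\<close>
  define collapse where "collapse = (\<lambda>i p e. over (gens i) p \<and> \<not> over X p \<and> over X e \<and> ?len e \<le> ?len p \<and>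
     (\<exists>y. set (list_decode y) \<subseteq> letters X \<and> ?len y \<le> ?len e \<and> P i (cat p y) \<and> P i (cat e y)))"
  have collapse: "collapse i (word_code p) (word_code e) \<longleftrightarrow>
    p \<in> words (gens i) \<and> p \<notin> words X \<and> e \<in> words X \<and> length e \<le> length p \<and> artin_eq (gens i) m p e" for i p e
  proof -
    have "(\<exists>y. set (list_decode y) \<subseteq> letters X \<and> ?len y \<le> ?len (word_code e) \<and>
        P i (cat (word_code p) y) \<and> P i (cat (word_code e) y)) \<longleftrightarrow> artin_eq (gens i) m p e"
      if p: "p \<in> words (gens i)" and e: "e \<in> words X"
    proof -
      have eg: "e \<in> words (gens i)" using words_X[OF e] .
      have "artin_eq (gens i) m p e" if y: "y \<in> words X" "artin_eq (gens i) m (p @ y) []" "artin_eq (gens i) m (e @ y) []" for y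
      proof -
        have yg: "y \<in> words (gens i)" using words_X[OF y(1)] .
        have 1: "artin_eq (gens i) m (q @ y @ word_inverse y) q" if "q \<in> words (gens i)" for q
          using pres_eq_append_left[OF pres_eq_word_inverse_right[OF yg] that] by simp
        have "artin_eq (gens i) m ((p @ y) @ word_inverse y) ((e @ y) @ word_inverse y)"
          by (rule pres_eq_append_right[OF pres_eq_trans[OF y(2) pres_eq_sym[OF y(3)]]]) (simp add: yg)
        then show ?thesis using 1[OF p] 1[OF eg]
          by simp (meson pres_eq_sym pres_eq_trans)
      qed
      moreover have "\<exists>y\<in>words X. length y \<le> length e \<and>
          artin_eq (gens i) m (p @ y) [] \<and> artin_eq (gens i) m (e @ y) []"
        if "artin_eq (gens i) m p e"
      proof (intro bexI conjI)
        show e_inv: "artin_eq (gens i) m (e @ word_inverse e) []"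
          using eg by (rule pres_eq_word_inverse_right)
        show "artin_eq (gens i) m (p @ word_inverse e) []"
          using pres_eq_append_right[OF that, of "word_inverse e"] eg e_inv by (auto intro: pres_eq_trans)
        show "word_inverse e \<in> words X" using e by simp
        show "length (word_inverse e) \<le> length e" by (simp add: word_inverse_def)
      qed
      ultimately have "(\<exists>y\<in>words X. length y \<le> length e \<and>
          artin_eq (gens i) m (p @ y) [] \<and> artin_eq (gens i) m (e @ y) []) \<longleftrightarrow> artin_eq (gens i) m p e"
        by blast
      moreover have "P i (word_code (q @ y)) \<longleftrightarrow> artin_eq (gens i) m (q @ y) []"
        if "q \<in> words (gens i)" "y \<in> words X" for q y
        using that words_X by (intro P(2)) simp
      ultimately show ?thesis
        unfolding ex_code set_word_code_subset cat using p eg by (auto simp: Bex_def cong: conj_cong)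
    qed
    then show ?thesis
      unfolding collapse_def over by auto
  qed
  have dec_collapse: "decidable 2 (\<lambda>xs. collapse i (xs ! 0) (xs ! 1))" for i
  proof -
    have sub: "X \<subseteq> S" by (auto simp: X_def)
    show ?thesis
      unfolding collapse_def
      by (intro computable_intros dec_over decidable_ex_list computable_length finite_letters
         finite_subset[OF sub fin] decidable_comp1[OF P(1)] comp_cat gens_S sub) auto
  qed

  define step where "step = (\<lambda>c c'. \<exists>u. set (list_decode u) \<subseteq> letters S \<and> ?len u \<le> ?len c \<and>
    (\<exists>p. set (list_decode p) \<subseteq> letters S \<and> ?len p \<le> ?len c \<and>
    (\<exists>v. set (list_decode v) \<subseteq> letters S \<and> ?len v \<le> ?len c \<and>
    (\<exists>e. set (list_decode e) \<subseteq> letters S \<and> ?len e \<le> ?len c \<and>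
      c = cat u (cat p v) \<and> c' = cat u (cat e v) \<and> (collapse True p e \<or> collapse False p e)))))"
  have dec_step: "decidable 2 (\<lambda>xs. step (xs ! 0) (xs ! 1))"
    unfolding step_def
    by (intro computable_intros decidable_ex_list computable_length finite_letters fin
        decidable_comp2[OF dec_collapse] comp_cat) auto
  have step: "step (word_code w) (word_code w') \<longleftrightarrow> (\<exists>u p v e i. w = u @ p @ v \<and> w' = u @ e @ v \<and>
     u \<in> words S \<and> v \<in> words S \<and> collapse i (word_code p) (word_code e))" for w w'
  proof -
    have eq: "step (word_code w) (word_code w') \<longleftrightarrow>
      (\<exists>u. u \<in> words S \<and> length u \<le> length w \<and> (\<exists>p. p \<in> words S \<and> length p \<le> length w \<and>
      (\<exists>v. v \<in> words S \<and> length v \<le> length w \<and> (\<exists>e. e \<in> words S \<and> length e \<le> length w \<and>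
        w = u @ p @ v \<and> w' = u @ e @ v \<and> (\<exists>i. collapse i (word_code p) (word_code e))))))"
      unfolding step_def ex_code set_word_code_subset cat word_code_inj ex_bool_eq
      by (simp only: list_decode_word_code length_map)
    show ?thesis
    proof
      assume "step (word_code w) (word_code w')"
      then show "\<exists>u p v e i. w = u @ p @ v \<and> w' = u @ e @ v \<and> u \<in> words S \<and> v \<in> words S \<and>
        collapse i (word_code p) (word_code e)" unfolding eq by blast
    next
      assume "\<exists>u p v e i. w = u @ p @ v \<and> w' = u @ e @ v \<and> u \<in> words S \<and> v \<in> words S \<and>
        collapse i (word_code p) (word_code e)"
      then obtain u p v e i where *: "w = u @ p @ v" "w' = u @ e @ v" "u \<in> words S" "v \<in> words S"
        "collapse i (word_code p) (word_code e)" by blast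
      then have "p \<in> words S" "e \<in> words S" "length e \<le> length p"
        using gens_S[of i] X_gens[of i] words_mono unfolding collapse by blast+
      moreover from this have "length u \<le> length w" "length p \<le> length w" "length v \<le> length w"
        "length e \<le> length w" using *(1) by auto
      ultimately show "step (word_code w) (word_code w')" unfolding eq using * by blast
    qed
  qed
  have step_eq: "w \<in> words S \<and> w' \<in> words S \<and> artin_eq S m w w' \<and> length w' \<le> length w"
    if ww': "step (word_code w) (word_code w')" for w w'
  proof -
    from ww' obtain u p v e i where *: "w = u @ p @ v" "w' = u @ e @ v" "u \<in> words S" "v \<in> words S"
      "collapse i (word_code p) (word_code e)" unfolding step by blast
    from *(5)[unfolded collapse] have "artin_eq (gens i) m p e" "length e \<le> length p" by auto
    then have pe: "artin_eq S m p e" "length e \<le> length p" using artin_eq_mono[OF _ gens_S] by auto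
    then have "p \<in> words S" "e \<in> words S" using pres_eq_words by metis+
    moreover have "artin_eq S m (u @ p @ v) (u @ e @ v)"
      by (intro pres_eq_append_left pres_eq_append_right pe *(3,4))
    ultimately show ?thesis using * pe(2) by simp
  qed

  have dec_irred: "decidable 1 (\<lambda>xs. \<nexists>c. step (xs ! 0) c)"
  proof -
    have "(\<exists>c'. step c c') \<longleftrightarrow> (\<exists>c'. set (list_decode c') \<subseteq> letters S \<and> ?len c' \<le> ?len c \<and> step c c')" for c
      unfolding ex_code set_word_code_subset using step_eq word_code_surj[of c]
      by (metis length_map list_decode_word_code)
    moreover have "decidable 1 (\<lambda>xs. \<not> (\<exists>c'. set (list_decode c') \<subseteq> letters S \<and>
         ?len c' \<le> ?len (xs ! 0) \<and> step (xs ! 0) c'))"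
      by (intro computable_intros decidable_ex_list computable_length finite_letters fin
        decidable_comp2[OF dec_step]) auto
    ultimately show ?thesis by simp
  qed
  define \<mu> where "\<mu> = (\<lambda>c. length (filter (\<lambda>a. a \<notin> letters X) (list_decode c)))"
  have \<mu>_less: "\<mu> c' < \<mu> c" if "step c c'" for c c'
  proof -
    obtain w w' where w: "c = word_code w" "c' = word_code w'" by (metis word_code_surj)
    have \<mu>_app: "\<mu> (word_code (u @ v)) = \<mu> (word_code u) + \<mu> (word_code v)" for u v by (simp add: \<mu>_def)
    have \<mu>0: "\<mu> (word_code u) = 0 \<longleftrightarrow> u \<in> words X" for u
      by (simp add: \<mu>_def filter_empty_conv flip: set_word_code_subset) auto
    obtain u p v e i where *: "w = u @ p @ v" "w' = u @ e @ v" 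
      "collapse i (word_code p) (word_code e)" using \<open>step c c'\<close> unfolding w step by blast
    then have "\<mu> (word_code e) = 0" "\<mu> (word_code p) \<noteq> 0" unfolding \<mu>0 collapse by auto
    then show ?thesis unfolding w * \<mu>_app by simp
  qed
  obtain nf where
    nf: "computable 1 (\<lambda>xs. nf (xs ! 0))" "\<And>c. step\<^sup>*\<^sup>* c (nf c)" "\<And>c c'. \<not> step (nf c) c'"
    by (rule computable_normal_form[of step \<mu>, OF dec_step dec_irred \<mu>_less]) (assumption, blast intro: that)

  define Q where "Q = (\<lambda>c. (over (gens True) (nf c) \<and> P True (nf c)) \<or> (over (gens False) (nf c) \<and> P False (nf c)))"
  have "decidable 1 (\<lambda>xs. Q (xs ! 0))"
    unfolding Q_def by (intro computable_intros dec_over decidable_comp1[OF P(1)] nf(1) gens_S)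
  moreover have "Q (word_code w) \<longleftrightarrow> artin_eq S m w []" if w: "w \<in> words S" for w
  proof -
    have "\<exists>w'. c' = word_code w' \<and> artin_eq S m w w'" if "step\<^sup>*\<^sup>* (word_code w) c'" for c'
      using that
    proof (induction rule: rtranclp_induct)
      case base
      show ?case using w pres_eq_refl by blast
    next
      case (step c c')
      then obtain w1 w2 where "c = word_code w1" "artin_eq S m w w1" "c' = word_code w2"
        by (metis word_code_surj)
      then show ?case using step.hyps(2) step_eq[of w1 w2] pres_eq_trans by blast
    qed
    then obtain w' where w': "nf (word_code w) = word_code w'" "artin_eq S m w w'" using nf(2) by blast
    have irr: "\<not> step (word_code w') c'" for c' using nf(3) w'(1) by metis
    have "Q (word_code w) \<longleftrightarrow> (\<exists>i. w' \<in> words (gens i) \<and> artin_eq (gens i) m w' [])"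
      unfolding Q_def w'(1) over using P(2) by (auto simp: ex_bool_eq)
    also have "\<dots> \<longleftrightarrow> artin_eq S m w' []"
    proof
      assume "artin_eq S m w' []"
      then have triv: "pres_eq (gens True \<union> gens False)
          (artin_relations (gens True) m \<union> artin_relations (gens False) m) w' []"
        by (simp only: all_gens all_rels)
      have wS: "w' \<in> words S" using w'(2) pres_eq_words by metis
      have "\<exists>i. w' \<in> words (gens i)"
      proof (rule ccontr)
        assume "\<nexists>i. w' \<in> words (gens i)"
        then obtain i u p v where *: "w' = u @ p @ v" "p \<in> words (gens i)" "p \<notin> words X" "in_base i p"
          using trivial_word_cases[OF triv] by blast
        then obtain c where c: "c \<in> words X" "artin_eq (gens i) m p c" unfolding in_base_def by blast
        have uv: "u \<in> words S" "v \<in> words S" using wS *(1) by auto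
        \<comment> \<open>the retraction of \<open>p\<close> is a word over \<open>X\<close> that is equal to \<open>p\<close> and not longer\<close>
        have "ret i c = c" using ret(4)[OF c(1), of i "[]"] ret(5) by simp
        then have "artin_eq X m (ret i p) c" using ret(3)[OF c(2)] by simp
        then have "artin_eq (gens i) m (ret i p) c" using X_gens by (rule artin_eq_mono)
        then have "artin_eq (gens i) m p (ret i p)" using c(2) by (meson pres_eq_sym pres_eq_trans)
        then have "collapse i (word_code p) (word_code (ret i p))"
          unfolding collapse using * ret(1,2) by blast
        then have "step (word_code w') (word_code (u @ ret i p @ v))"
          unfolding step using *(1) uv by blast
        then show False using irr by blast
      qed
      then show "\<exists>i. w' \<in> words (gens i) \<and> artin_eq (gens i) m w' []"
        using \<open>artin_eq S m w' []\<close> artin_eq_parabolic[OF S gens_S] by blast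
    qed (use artin_eq_mono gens_S in blast)
    also have "\<dots> \<longleftrightarrow> artin_eq S m w []" using w'(2) by (meson pres_eq_sym pres_eq_trans)
    finally show ?thesis .
  qed
  ultimately show ?thesis unfolding word_decidable_def by blast
qed

lemma word_decidable_all:
  fixes S :: "nat set"
  assumes free: "\<And>S. coxeter_matrix S m \<Longrightarrow> free_of_infinity S m \<Longrightarrow> word_decidable S m"
    and "coxeter_matrix S m"
  shows "word_decidable S m"
  using assms(2)
proof (induction "card S" arbitrary: S rule: less_induct)
  case less
  show ?case
  proof (cases "free_of_infinity S m")
    case True
    then show ?thesis using free less.prems by blast
  next
    case False
    then obtain s t where st: "s \<in> S" "t \<in> S" "m s t = \<infinity>"
      by (auto simp: free_of_infinity_def)
    have "finite S" using less.prems by (simp add: coxeter_matrix_def)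
    then have "word_decidable (S - {x}) m" if "x \<in> S" for x
      using less.hyps[OF card_Diff1_less[OF _ that]] coxeter_matrix_subset[OF less.prems] by blast
    then show ?thesis using word_decidable_amalgam[OF less.prems st] st by blast
  qed
qed

theorem theoremC:
  fixes S :: "'v set" and m :: "'v \<Rightarrow> 'v \<Rightarrow> enat"
  assumes "\<forall>(S' :: nat set) (m' :: nat \<Rightarrow> nat \<Rightarrow> enat).
      coxeter_matrix S' m' \<and> free_of_infinity S' m' \<longrightarrow>
      solvable_word_problem (artin_group S' m') (artin_generators S' m')"
    and "coxeter_matrix S m"
  shows "solvable_word_problem (artin_group S m) (artin_generators S m)"
proof -
  have "finite S" using assms(2) by (simp add: coxeter_matrix_def)
  then obtain h :: "'v \<Rightarrow> nat" where h: "inj_on h S"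
    using finite_imp_inj_to_nat_seg by metis
  define m' where "m' = (\<lambda>a b. m (inv_into S h a) (inv_into S h b))"
  have m': "m' (h s) (h t) = m s t" if "s \<in> S" "t \<in> S" for s t
    using that h by (simp add: m'_def)
  have cox: "coxeter_matrix (h ` S) m'"
    using assms(2) h unfolding coxeter_matrix_def by (auto simp: m' inj_on_eq_iff)
  have free: "word_decidable S' m'" if "coxeter_matrix S' m'" "free_of_infinity S' m'" for S'
    using that assms(1) by (intro solvable_imp_word_decidable) (auto simp: coxeter_matrix_def)
  from h m' word_decidable_all[OF free cox] show ?thesis by (rule word_decidable_imp_solvable)
qed

end
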